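(* Let $C$ be a computable subgroup of $PL_+(I)$. Let $H$ be a subgroup of $C$ generated by a finite set of one-bump functions with fundamental domains. Then the membership decision problem is solvable for $H$; that is, there is an algorithm which, upon input of an element $w$ of $C$, can determine whether $w\in H$.
   Context: $PL_+(I)$ is the group of orientation-preserving piecewise-linear homeomorphisms of $I=[0,1]$ with finitely many breaks in slope, acting on the right ($x\cdot g$ is the image of $x$ under $g$). The support of $g$ is $\mathrm{Supp}(g)=\{x\in[0,1] : xg\ne x\}$; an orbital (component of support) of $g$ is a connected component (open interval) of $\mathrm{Supp}(g)$. A breakpoint of $g$ is a point of $(0,1)$ where the derivative of $g$ does not exist; $\mathscr{B}_g$ is the set of breakpoints of $g$. A signed orbital is a pair $(A,g)$ with $g\in PL_+(I)$ and $A$ an orbital of $g$; it is associated with a group $G$ if $g\in G$. A set $X\subset PL_+(I)$ is a set of one-bump functions with fundamental domains if: (Z0) Each $h\in X$ has exactly one component of support, denoted $A_h$. (Z1) No pair of elements of $X$ forms a transition chain or a one-sided overlap. (Two elements with components of support $(a,b)$ and $(c,d)$, respectively, with $a<c<b<d$ form a transition chain; two elements with components of support $(a,b),(a,c)$ or $(a,b),(c,b)$, respectively, with $a<c<b$ form a one-sided overlap.) (Z2) If $h,h'\in X$ and $h\ne h'$, then $A_h\neq A_{h'}$. (Z3) For each $h\in X$ there is an $r_h\in A_h$ such that for every $h'\in X$ with $A_{h'}\subsetneq A_h$, the containment $A_{h'}\subseteq (r_h,r_h\cdot h)$ also holds. One-bump factors: if $f$ has orbitals $A_1,\dots,A_k$,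 the one-bump factors of $f$ are the elements $f_1,\dots,f_k$ of $PL_+(I)$ with $f_i|_{A_i}=f|_{A_i}$ and $f_i$ the identity off $A_i$; the pairs $(A_i,f_i)$ are the factor signed orbitals associated to $f$. The split group $S(G)$ of $G\le PL_+(I)$ is the subgroup of $PL_+(I)$ generated by the one-bump factors of all elements of $G$. The slope group $\Pi_G$ is the multiplicative subgroup of the positive reals $\mathbb{R}_+^*$ generated by the slopes of affine components of elements of $G$; one has $\Pi_{S(G)}=\Pi_G$. A multiplicative subgroup of $\mathbb{R}_+^*$ is discrete if there is a positive lower bound on the distance from $1$ of its non-identity elements. A subgroup $C\le PL_+(I)$ is computable if the elements of $C$ have representatives (some data structure) for which the following processes can be carried out by a computer: (1) Given $g,h\in S(C)$, determine $gh$ and $g^{-1}$. (2) Given $g\in C$, determine its set of breakpoints $\mathscr{B}_g$. (3) Given $g\in S(C)$ and a breakpoint or orbital endpoint $x$ of $S(C)$, compute $x\cdot g$. (4) Given two points $a,b\in[0,1]$ that occur either as breakpoints or as orbital endpoints of elements of $S(C)$, determine whether $a<b$, $a=b$, or $a>b$. (5) Given $g\in S(C)$, produce the finite tuple $[A_1,\dots,A_{k_g}]$ of all orbitals of $g$, where each $A_i$ is stored as the ordered pair $(a_i,b_i)=(\inf A_i,\sup A_i)$ and $a_1<a_2<\dots<a_{k_g}$. (6) Given a signed orbital $(A,g)$ associated with $S(C)$, output the factor signed orbital $(A,h)$ satisfying $h|_A=g|_A$ and $\mathrm{Supp}(h)=A$. (7) Given a signed orbital $((a,b),g)$ of $S(C)$,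 determine the slopes of the affine components of the graph of $g$ over $(a,b)$ near $a$ and near $b$ (the right derivative of $g$ at $a$ and the left derivative of $g$ at $b$). (8) Given two elements $m_1,m_2$ of $\Pi_C=\Pi_{S(C)}$, compute $m_1m_2$ and $m_1^{-1}$, and determine whether $m_1<m_2$, $m_1=m_2$, or $m_1>m_2$. (9) Given a finite set $\{m_1,\dots,m_k\}$ of positive numbers in $\Pi_C$, determine whether the multiplicative group $\langle m_1,\dots,m_k\rangle\le\mathbb{R}_+^*$ is discrete; if it is discrete, further determine integers $p_1,\dots,p_k$ such that $m_1^{p_1}\cdots m_k^{p_k}$ is the least value in this group greater than one. The input $w$ is given by a representative in this data structure. *)

theory Defs
  imports
    "HOL-Analysis.Analysis"
    "HOL-Algebra.Generated_Groups"
    "HOL-Library.Nat_Bijection"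
begin

section \<open>Partial recursive functions\<close>

text \<open>
  Kleene's partial recursive functions, in unary form: several arguments are packed into one
  natural number by the Cantor pairing function \<^const>\<open>prod_encode\<close>.
\<close>

inductive partrec :: "(nat \<rightharpoonup> nat) \<Rightarrow> bool" where
  zero: "partrec (\<lambda>n. Some 0)"
| succ: "partrec (\<lambda>n. Some (Suc n))"
| left: "partrec (\<lambda>n. Some (fst (prod_decode n)))"
| right: "partrec (\<lambda>n. Some (snd (prod_decode n)))"
| pair: "\<lbrakk>partrec f; partrec g\<rbrakk> \<Longrightarrow>
    partrec (\<lambda>n. Option.bind (f n) (\<lambda>a. Option.bind (g n) (\<lambda>b. Some (prod_encode (a, b)))))"
| comp: "\<lbrakk>partrec f; partrec g\<rbrakk> \<Longrightarrow> partrec (\<lambda>n. Option.bind (g n) f)"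
| prec: "\<lbrakk>partrec f; partrec g\<rbrakk> \<Longrightarrow>
    partrec (\<lambda>n. case prod_decode n of (a, m) \<Rightarrow>
      rec_nat (f a) (\<lambda>y r. Option.bind r (\<lambda>i. g (prod_encode (a, prod_encode (y, i))))) m)"
| mu: "partrec f \<Longrightarrow>
    partrec (\<lambda>a.
      if \<exists>n. f (prod_encode (a, n)) = Some 0 \<and> (\<forall>k<n. f (prod_encode (a, k)) \<noteq> None)
      then Some (LEAST n. f (prod_encode (a, n)) = Some 0) else None)"


section \<open>Representatives and computer processes\<close>

text \<open>
  A data structure for the elements of a set \<open>A\<close> is a partial map \<open>\<nu> :: nat \<rightharpoonup> 'a\<close> with
  range \<open>A\<close>: \<open>\<nu> n = Some x\<close> says that the number \<open>n\<close> is a representative of \<open>x\<close>. An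
  element may have several representatives, and being a representative need not be decidable.
\<close>

definition pair_rep :: "(nat \<rightharpoonup> 'a) \<Rightarrow> (nat \<rightharpoonup> 'b) \<Rightarrow> (nat \<rightharpoonup> 'a \<times> 'b)" where
  "pair_rep \<nu> \<mu> n =
    Option.bind (\<nu> (fst (prod_decode n))) (\<lambda>x.
    Option.bind (\<mu> (snd (prod_decode n))) (\<lambda>y. Some (x, y)))"

definition list_rep :: "(nat \<rightharpoonup> 'a) \<Rightarrow> (nat \<rightharpoonup> 'a list)" where
  "list_rep \<nu> n = those (map \<nu> (list_decode n))"

definition bool_rep :: "nat \<rightharpoonup> bool" where
  "bool_rep = [0 \<mapsto> False, 1 \<mapsto> True]"

definition int_rep :: "nat \<rightharpoonup> int" where
  "int_rep n = Some (int_decode n)"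

text \<open>
  The task ``given \<open>x \<in> D\<close>, determine some \<open>y\<close> with \<open>T x y\<close>'' can be carried out by a computer.
  The algorithm has to halt only on representatives of elements of \<open>D\<close>, and its output may
  depend on the representative chosen.
\<close>

definition computable_task ::
    "(nat \<rightharpoonup> 'a) \<Rightarrow> 'a set \<Rightarrow> (nat \<rightharpoonup> 'b) \<Rightarrow> ('a \<Rightarrow> 'b \<Rightarrow> bool) \<Rightarrow> bool" where
  "computable_task \<nu> D \<mu> T \<longleftrightarrow>
    (\<exists>\<phi>. partrec \<phi> \<and>
      (\<forall>n x. \<nu> n = Some x \<longrightarrow> x \<in> D \<longrightarrow>
        (\<exists>m y. \<phi> n = Some m \<and> \<mu> m = Some y \<and> T x y)))"


section \<open>Piecewise-linear homeomorphisms of the unit interval\<close>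

text \<open>Elements are extended to the real line by the identity off \<open>[0, 1]\<close>.\<close>

definition PL_plus :: "(real \<Rightarrow> real) set" where
  "PL_plus = {g.
     (\<exists>g'. homeomorphism {0..1} {0..1} g g') \<and>
     strict_mono_on {0..1} g \<and>
     (\<forall>x. x \<notin> {0..1} \<longrightarrow> g x = x) \<and>
     (\<exists>B. finite B \<and>
       (\<forall>a b. {a<..<b} \<subseteq> {0..1} - B \<longrightarrow> (\<exists>m c. \<forall>x\<in>{a<..<b}. g x = m * x + c)))}"

text \<open>The action is on the right, so the product \<open>g h\<close> applies \<open>g\<close> first; \<open>x \<cdot> g\<close> is \<open>g x\<close>.\<close>

definition PL_group :: "(real \<Rightarrow> real) monoid" where
  "PL_group = \<lparr>carrier = PL_plus, mult = (\<lambda>g h. h \<circ> g), one = id\<rparr>"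

definition Supp :: "(real \<Rightarrow> real) \<Rightarrow> real set" where
  "Supp g = {x\<in>{0..1}. g x \<noteq> x}"

definition orbitals :: "(real \<Rightarrow> real) \<Rightarrow> real set set" where
  "orbitals g = components (Supp g)"

definition orbital_ends :: "(real \<Rightarrow> real) \<Rightarrow> real set" where
  "orbital_ends g = Inf ` orbitals g \<union> Sup ` orbitals g"

definition breakpoints :: "(real \<Rightarrow> real) \<Rightarrow> real set" where
  "breakpoints g = {x\<in>{0<..<1}. \<not> g differentiable (at x)}"

definition one_bump_factor :: "(real \<Rightarrow> real) \<Rightarrow> real set \<Rightarrow> (real \<Rightarrow> real)" where
  "one_bump_factor g A = (\<lambda>x. if x \<in> A then g x else x)"

definition split_group :: "(real \<Rightarrow> real) set \<Rightarrow> (real \<Rightarrow> real) set" where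
  "split_group G = generate PL_group {one_bump_factor g A |g A. g \<in> G \<and> A \<in> orbitals g}"

definition special_points :: "(real \<Rightarrow> real) set \<Rightarrow> real set" where
  "special_points G = (\<Union>g\<in>G. breakpoints g \<union> orbital_ends g)"

definition slopes :: "(real \<Rightarrow> real) \<Rightarrow> real set" where
  "slopes g = {m. \<exists>a b c. 0 \<le> a \<and> a < b \<and> b \<le> 1 \<and> (\<forall>x\<in>{a<..<b}. g x = m * x + c)}"

definition pos_reals :: "real monoid" where
  "pos_reals = \<lparr>carrier = {0<..}, mult = (*), one = 1\<rparr>"

definition slope_group :: "(real \<Rightarrow> real) set \<Rightarrow> real set" where
  "slope_group G = generate pos_reals (\<Union>g\<in>G. slopes g)"

definition discrete_mult :: "real set \<Rightarrow> bool" where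
  "discrete_mult M \<longleftrightarrow> (\<exists>\<epsilon>>0. \<forall>m\<in>M. m \<noteq> 1 \<longrightarrow> \<epsilon> \<le> \<bar>m - 1\<bar>)"


section \<open>Sets of one-bump functions with fundamental domains\<close>

definition bump_supp :: "(real \<Rightarrow> real) \<Rightarrow> real set" where
  "bump_supp h = (THE A. orbitals h = {A})"

definition transition_chain :: "real set \<Rightarrow> real set \<Rightarrow> bool" where
  "transition_chain A B \<longleftrightarrow>
    (\<exists>a b c d. A = {a<..<b} \<and> B = {c<..<d} \<and> a < c \<and> c < b \<and> b < d)"

definition one_sided_overlap :: "real set \<Rightarrow> real set \<Rightarrow> bool" where
  "one_sided_overlap A B \<longleftrightarrow>
    (\<exists>a b c. a < c \<and> c < b \<and>
      (A = {a<..<b} \<and> B = {a<..<c} \<or> A = {a<..<b} \<and> B = {c<..<b}))"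

text \<open>
  In the last clause \<open>(r, r \<cdot> h)\<close> is the interval \<open>{r<..<h r}\<close>, which is empty if \<open>h\<close> moves points
  to the left; such an \<open>h\<close> must be replaced by its inverse before other bumps can be nested in it.
\<close>

definition one_bumps_with_fundamental_domains :: "(real \<Rightarrow> real) set \<Rightarrow> bool" where
  "one_bumps_with_fundamental_domains X \<longleftrightarrow>
    X \<subseteq> PL_plus \<and>
    (\<forall>h\<in>X. \<exists>A. orbitals h = {A}) \<and>
    (\<forall>h\<in>X. \<forall>h'\<in>X.
      \<not> transition_chain (bump_supp h) (bump_supp h') \<and>
      \<not> one_sided_overlap (bump_supp h) (bump_supp h')) \<and>
    (\<forall>h\<in>X. \<forall>h'\<in>X. h \<noteq> h' \<longrightarrow> bump_supp h \<noteq> bump_supp h') \<and>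
    (\<forall>h\<in>X. \<exists>r\<in>bump_supp h. \<forall>h'\<in>X.
      bump_supp h' \<subset> bump_supp h \<longrightarrow> bump_supp h' \<subseteq> {r<..<h r})"


section \<open>Computable subgroups\<close>

text \<open>
  \<open>\<nu>\<close>, \<open>\<pi>\<close> and \<open>\<sigma>\<close> are the data structure: representatives of the elements of \<open>S(C)\<close> (which
  contains \<open>C\<close>), of the breakpoints and orbital endpoints of elements of \<open>S(C)\<close>, and of the
  elements of \<open>\<Pi>\<^sub>C\<close>. A finite set is input and output as a list of its elements; an open interval
  is given by its pair of endpoints; the result of comparing \<open>a\<close> with \<open>b\<close> is the pair of truth
  values of \<open>a < b\<close> and \<open>a = b\<close>.

  In \<open>discreteness\<close>, exponents are required only when the group is discrete and nontrivial,
  since the trivial group has no least element above \<open>1\<close>.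
\<close>

locale computable_subgroup =
  fixes C :: "(real \<Rightarrow> real) set"
    and \<nu> :: "nat \<rightharpoonup> (real \<Rightarrow> real)"
    and \<pi> :: "nat \<rightharpoonup> real"
    and \<sigma> :: "nat \<rightharpoonup> real"
  assumes subgroup_C: "subgroup C PL_group"
    and ran_\<nu>: "ran \<nu> = split_group C"
    and ran_\<pi>: "ran \<pi> = special_points (split_group C)"
    and ran_\<sigma>: "ran \<sigma> = slope_group C"
    and multiply:
      "computable_task (pair_rep \<nu> \<nu>) UNIV \<nu> (\<lambda>(g, h) k. k = g \<otimes>\<^bsub>PL_group\<^esub> h)"
    and invert:
      "computable_task \<nu> UNIV \<nu> (\<lambda>g k. k = inv\<^bsub>PL_group\<^esub> g)"
    and find_breakpoints:
      "computable_task \<nu> C (list_rep \<pi>) (\<lambda>g bs. set bs = breakpoints g)"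
    and apply_element:
      "computable_task (pair_rep \<nu> \<pi>) UNIV \<pi> (\<lambda>(g, x) y. y = g x)"
    and compare_points:
      "computable_task (pair_rep \<pi> \<pi>) UNIV (pair_rep bool_rep bool_rep)
        (\<lambda>(a, b) (lt, eq). (lt \<longleftrightarrow> a < b) \<and> (eq \<longleftrightarrow> a = b))"
    and find_orbitals:
      "computable_task \<nu> UNIV (list_rep (pair_rep \<pi> \<pi>))
        (\<lambda>g As. set As = (\<lambda>A. (Inf A, Sup A)) ` orbitals g \<and>
          sorted_wrt (\<lambda>(a, _) (a', _). a < a') As)"
    and find_factor:
      "computable_task (pair_rep (pair_rep \<pi> \<pi>) \<nu>) {((a, b), g). {a<..<b} \<in> orbitals g}
        (pair_rep (pair_rep \<pi> \<pi>) \<nu>)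
        (\<lambda>((a, b), g) ((a', b'), h). a' = a \<and> b' = b \<and>
          (\<forall>x\<in>{a<..<b}. h x = g x) \<and> Supp h = {a<..<b})"
    and find_end_slopes:
      "computable_task (pair_rep (pair_rep \<pi> \<pi>) \<nu>) {((a, b), g). {a<..<b} \<in> orbitals g}
        (pair_rep \<sigma> \<sigma>)
        (\<lambda>((a, b), g) (m, m').
          (g has_real_derivative m) (at_right a) \<and> (g has_real_derivative m') (at_left b))"
    and multiply_slopes:
      "computable_task (pair_rep \<sigma> \<sigma>) UNIV \<sigma> (\<lambda>(m\<^sub>1, m\<^sub>2) m. m = m\<^sub>1 * m\<^sub>2)"
    and invert_slope:
      "computable_task \<sigma> UNIV \<sigma> (\<lambda>m m'. m' = inverse m)"
    and compare_slopes:
      "computable_task (pair_rep \<sigma> \<sigma>) UNIV (pair_rep bool_rep bool_rep)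
        (\<lambda>(m\<^sub>1, m\<^sub>2) (lt, eq). (lt \<longleftrightarrow> m\<^sub>1 < m\<^sub>2) \<and> (eq \<longleftrightarrow> m\<^sub>1 = m\<^sub>2))"
    and discreteness:
      "computable_task (list_rep \<sigma>) UNIV (pair_rep bool_rep (list_rep int_rep))
        (\<lambda>ms (disc, ps).
          let M = generate pos_reals (set ms);
              v = (\<Prod>i<length ms. (ms ! i) powi (ps ! i))
          in (disc \<longleftrightarrow> discrete_mult M) \<and>
             (disc \<and> M \<noteq> {1} \<longrightarrow>
               length ps = length ms \<and> v \<in> M \<and> 1 < v \<and> (\<forall>u\<in>M. 1 < u \<longrightarrow> v \<le> u)))"

text \<open>The input is a representative, in the given data structure, of an element of \<open>C\<close>.\<close>

definition membership_decidable ::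
    "(nat \<rightharpoonup> (real \<Rightarrow> real)) \<Rightarrow> (real \<Rightarrow> real) set \<Rightarrow> (real \<Rightarrow> real) set \<Rightarrow> bool" where
  "membership_decidable \<nu> C H \<longleftrightarrow> computable_task \<nu> C bool_rep (\<lambda>w b. b \<longleftrightarrow> w \<in> H)"

end

theory Submission
  imports Defs
begin

text \<open>
  Call a subgroup good if it contains the one-bump factors of its elements and if membership in it
  is decidable on all of \<open>S(C)\<close>; an element lies in a good subgroup iff all its one-bump factors
  do. That the group generated by \<open>X\<close> is good follows by induction on \<open>X\<close>. Let \<open>h\<close> be a bump with
  maximal support \<open>(a, b)\<close>, let \<open>T\<close> be the set of bumps below it and \<open>R\<close> the set of those disjoint
  from it. An orbital of an element of the group lies either inside or outside of \<open>(a, b)\<close>, which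
  reduces the problem to the groups generated by \<open>T \<union> {h}\<close> and by \<open>R\<close>.

  Replacing \<open>h\<close> by its inverse if necessary, there is a breakpoint or orbital endpoint \<open>c\<close> in
  \<open>(a, b)\<close> such that \<open>T\<close> lives on the fundamental domain \<open>(c, c h)\<close>. The group generated by
  \<open>T \<union> {h}\<close> is the wreath product of \<open>\<langle>T\<rangle>\<close> with the integers. An element \<open>w\<close> of it translates the
  fundamental domains by the number \<open>n\<close> with \<open>c w = c h\<^sup>n\<close>, which an unbounded search finds by
  locating \<open>c w\<close>; and \<open>w\<close> is in the group iff each one-bump factor of \<open>w h\<^sup>-\<^sup>n\<close> is conjugated into
  \<open>\<langle>T\<rangle>\<close> by the power of \<open>h\<close> that moves its orbital to \<open>(c, c h)\<close>. Since \<open>X\<close> is fixed, the induction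
  takes place outside of the algorithm.
\<close>

section \<open>Computable tasks\<close>

lemma partrec_const: "partrec (\<lambda>n. Some k)"
proof (induction k)
  case 0
  show ?case by (rule partrec.zero)
next
  case (Suc k)
  show ?case using partrec.comp[OF partrec.succ Suc] by simp
qed

lemma partrec_id: "partrec (\<lambda>n. Some n)"
  using partrec.pair[OF partrec.left partrec.right] by simp

text \<open>The constructor \<open>prec\<close> expects its parameter and its bound packed together.
  Here the whole input serves as the parameter and the bound \<open>e n\<close> is computed from it,
  which is the form in which recursion is needed below.\<close>

lemma partrec_rec:
  assumes "partrec f" "partrec g" "partrec e"
  shows "partrec (\<lambda>n. Option.bind (e n) (\<lambda>m.
    rec_nat (f n) (\<lambda>y r. Option.bind r (\<lambda>i. g (prod_encode (n, prod_encode (y, i))))) m))"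
  using partrec.comp[OF partrec.prec[OF assms(1,2)] partrec.pair[OF partrec_id assms(3)]]
  by (simp add: Option.bind_assoc)

text \<open>Recursion whose step forgets the accumulated value and returns its own index.\<close>

lemma partrec_pred: "partrec (\<lambda>n. Some (n - 1))"
proof -
  have "partrec (\<lambda>n. Some (fst (prod_decode (snd (prod_decode n)))))"
    using partrec.comp[OF partrec.left partrec.right] by simp
  from partrec_rec[OF partrec_const[of 0] this partrec_id]
  have "partrec (\<lambda>n. rec_nat (Some 0) (\<lambda>y r. Option.bind r (\<lambda>i. Some y)) n)"
    by simp
  moreover have "rec_nat (Some 0) (\<lambda>y r. Option.bind r (\<lambda>i. Some y)) n = Some (n - 1)" for n
    by (induction n) auto
  ultimately show ?thesis by simp
qed

lemma partrec_is_zero: "partrec (\<lambda>n. Some (if n = 0 then 1 else 0))"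
proof -
  from partrec_rec[OF partrec_const[of 1] partrec_const[of 0] partrec_id]
  have "partrec (\<lambda>n. rec_nat (Some 1) (\<lambda>y r. Option.bind r (\<lambda>i. Some 0)) n)"
    by simp
  moreover have "rec_nat (Some (Suc 0)) (\<lambda>y r. Option.bind r (\<lambda>i. Some 0)) n
      = Some (if n = 0 then 1 else 0)" for n :: nat
    by (induction n) auto
  ultimately show ?thesis by simp
qed

lemma partrec_if:
  assumes "partrec e" "partrec f" "partrec g"
  shows "partrec (\<lambda>n. Option.bind (e n) (\<lambda>b. if b = 0 then f n else g n))"
proof -
  \<comment> \<open>Primitive recursion along a number that is \<open>0\<close> evaluates only its base case, which makes the
    case distinction lazy.\<close>
  define f' where "f' n = Option.bind (e n) (\<lambda>b. if b = 0 then f n else Some 0)" for n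
  have left': "partrec (\<lambda>n. h (fst (prod_decode n)))" if "partrec h" for h
    using partrec.comp[OF that partrec.left] by simp
  have e': "partrec (\<lambda>n. Option.bind (e n) (\<lambda>b. Some (if b = 0 then 1 else 0)))"
    using partrec.comp[OF partrec_is_zero assms(1)] .
  have rec1: "rec_nat (Some 0) (\<lambda>y r. Option.bind r (\<lambda>i. h)) m = (if m = 0 then Some 0 else h)"
    for h :: "nat option" and m :: nat
  proof (induction m)
    case (Suc m)
    then show ?case by (cases h) auto
  qed simp
  have "(if (if b = 0 then 1 else 0) = (0::nat) then x else y) = (if b = 0 then y else x)"
    for b :: nat and x y :: "nat option"
    by simp
  with partrec_rec[OF partrec_const[of 0] left'[OF assms(2)] e']
  have "partrec f'"
    by (simp add: rec1 f'_def[abs_def] Option.bind_assoc cong: if_cong)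
  moreover have rec2: "rec_nat (Some a) (\<lambda>y r. Option.bind r (\<lambda>i. h)) m
      = (if m = 0 then Some a else h)" for h :: "nat option" and m a :: nat
  proof (induction m)
    case (Suc m)
    then show ?case by (cases h) auto
  qed simp
  \<comment> \<open>The base case of this second recursion is always evaluated. This is why
    \<open>f'\<close> gives the harmless default \<open>0\<close> in place of a possibly undefined
    \<open>f n\<close> when \<open>g\<close> is to be taken; any positive number of steps then
    yields \<open>g n\<close>.\<close>
  ultimately have "partrec (\<lambda>n. Option.bind (e n) (\<lambda>m.
      rec_nat (f' n) (\<lambda>y r. Option.bind r (\<lambda>i. g n)) m))"
    using partrec_rec[OF _ left'[OF assms(3)] assms(1), of f'] by simp
  moreover have "Option.bind (e n) (\<lambda>m. rec_nat (f' n) (\<lambda>y r. Option.bind r (\<lambda>i. g n)) m)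
      = Option.bind (e n) (\<lambda>b. if b = 0 then f n else g n)" for n
  proof (cases "e n")
    case (Some b)
    then show ?thesis by (cases "b = 0") (auto simp: f'_def rec2)
  qed simp
  ultimately show ?thesis by simp
qed

section \<open>Representatives and combinations of computable tasks\<close>

lemma bool_rep_simps [simp]: "bool_rep 0 = Some False" "bool_rep (Suc 0) = Some True"
  by (auto simp: bool_rep_def)

lemma bool_rep_iff: "bool_rep m = Some b \<longleftrightarrow> m = of_bool b"
  by (auto simp: bool_rep_def)

lemma pair_rep_iff: "pair_rep \<nu> \<mu> n = Some (x, y) \<longleftrightarrow>
    \<nu> (fst (prod_decode n)) = Some x \<and> \<mu> (snd (prod_decode n)) = Some y"
  by (auto simp: pair_rep_def bind_eq_Some_conv)

lemma pair_rep_encode [simp]: "pair_rep \<nu> \<mu> (prod_encode (a, b)) = Some (x, y) \<longleftrightarrow>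
    \<nu> a = Some x \<and> \<mu> b = Some y"
  by (simp add: pair_rep_iff)

lemma list_rep_iff:
  "list_rep \<mu> n = Some xs \<longleftrightarrow> list_all2 (\<lambda>k x. \<mu> k = Some x) (list_decode n) xs"
proof -
  have "those (map \<mu> ks) = Some xs \<longleftrightarrow> list_all2 (\<lambda>k x. \<mu> k = Some x) ks xs" for ks
  proof (induction ks arbitrary: xs)
    case (Cons k ks)
    then show ?case by (cases xs) (auto split: option.splits)
  qed auto
  then show ?thesis by (simp add: list_rep_def)
qed

lemma computable_taskI:
  assumes "partrec \<phi>"
    and "\<And>n x. \<nu> n = Some x \<Longrightarrow> x \<in> D \<Longrightarrow> \<exists>m y. \<phi> n = Some m \<and> \<mu> m = Some y \<and> T x y"
  shows "computable_task \<nu> D \<mu> T"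
  using assms unfolding computable_task_def by blast

text \<open>An algorithm only ever meets represented elements, so both the change of domain and the
  weakening of the specification may be justified on the ranges alone. This is how the
  specifications of the given processes are brought into functional form.\<close>

lemma computable_task_mono:
  assumes "computable_task \<nu> D \<mu> T"
    and "D' \<inter> ran \<nu> \<subseteq> D"
    and "\<And>x y. x \<in> D' \<Longrightarrow> x \<in> ran \<nu> \<Longrightarrow> T x y \<Longrightarrow> y \<in> ran \<mu> \<Longrightarrow> T' x y"
  shows "computable_task \<nu> D' \<mu> T'"
  using assms unfolding computable_task_def by (meson IntI in_mono ranI)

abbreviation computable_fun ::
    "(nat \<rightharpoonup> 'a) \<Rightarrow> 'a set \<Rightarrow> (nat \<rightharpoonup> 'b) \<Rightarrow> ('a \<Rightarrow> 'b) \<Rightarrow> bool" where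
  "computable_fun \<nu> D \<mu> F \<equiv> computable_task \<nu> D \<mu> (\<lambda>x y. y = F x)"

text \<open>The intermediate answer need not be determined by the input, for instance when it comes
  from a search, so it stays existentially quantified in the specification of the composite. The
  input is handed on together with it.\<close>

lemma computable_task_bind:
  assumes "computable_task \<rho> D \<mu> T"
    and "computable_task (pair_rep \<rho> \<mu>) E \<kappa> U"
    and "\<And>s y. s \<in> D \<Longrightarrow> s \<in> ran \<rho> \<Longrightarrow> y \<in> ran \<mu> \<Longrightarrow> T s y \<Longrightarrow> (s, y) \<in> E"
  shows "computable_task \<rho> D \<kappa> (\<lambda>s z. \<exists>y. T s y \<and> y \<in> ran \<mu> \<and> U (s, y) z)"
proof -
  obtain f where f: "partrec f"
      "\<And>n x. \<rho> n = Some x \<Longrightarrow> x \<in> D \<Longrightarrow> \<exists>m y. f n = Some m \<and> \<mu> m = Some y \<and> T x y"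
    using assms(1) unfolding computable_task_def by blast
  obtain g where g: "partrec g" "\<And>n x. pair_rep \<rho> \<mu> n = Some x \<Longrightarrow> x \<in> E \<Longrightarrow>
      \<exists>m y. g n = Some m \<and> \<kappa> m = Some y \<and> U x y"
    using assms(2) unfolding computable_task_def by blast
  have "partrec (\<lambda>n. Option.bind (f n) (\<lambda>m. g (prod_encode (n, m))))"
    using partrec.comp[OF g(1) partrec.pair[OF partrec_id f(1)]] by (simp add: Option.bind_assoc)
  then show ?thesis
  proof (rule computable_taskI)
    fix n x assume nx: "\<rho> n = Some x" "x \<in> D"
    then obtain m y where m: "f n = Some m" "\<mu> m = Some y" "T x y" using f(2) by blast
    with nx have "(x, y) \<in> E" using assms(3) by (meson ranI)
    then obtain k z where "g (prod_encode (n, m)) = Some k" "\<kappa> k = Some z" "U (x, y) z"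
      using g(2)[of "prod_encode (n, m)" "(x, y)"] nx m by auto
    then show "\<exists>k z. Option.bind (f n) (\<lambda>m. g (prod_encode (n, m))) = Some k \<and> \<kappa> k = Some z \<and>
        (\<exists>y. T x y \<and> y \<in> ran \<mu> \<and> U (x, y) z)"
      using m by (auto intro: ranI)
  qed
qed

lemma computable_task_comp:
  assumes "computable_fun \<rho> D \<mu> F" "computable_task \<mu> E \<kappa> U"
    and "\<And>s. s \<in> D \<Longrightarrow> s \<in> ran \<rho> \<Longrightarrow> F s \<in> ran \<mu> \<Longrightarrow> F s \<in> E"
  shows "computable_task \<rho> D \<kappa> (\<lambda>s. U (F s))"
proof -
  obtain f where f: "partrec f"
      "\<And>n x. \<rho> n = Some x \<Longrightarrow> x \<in> D \<Longrightarrow> \<exists>m. f n = Some m \<and> \<mu> m = Some (F x)"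
    using assms(1) unfolding computable_task_def by blast
  obtain g where g: "partrec g"
      "\<And>n x. \<mu> n = Some x \<Longrightarrow> x \<in> E \<Longrightarrow> \<exists>m y. g n = Some m \<and> \<kappa> m = Some y \<and> U x y"
    using assms(2) unfolding computable_task_def by blast
  show ?thesis
  proof (rule computable_taskI[OF partrec.comp[OF g(1) f(1)]])
    fix n x assume nx: "\<rho> n = Some x" "x \<in> D"
    then obtain m where m: "f n = Some m" "\<mu> m = Some (F x)" using f(2) by blast
    with nx have "F x \<in> E" using assms(3) by (meson ranI)
    with g(2) m show "\<exists>k z. Option.bind (f n) g = Some k \<and> \<kappa> k = Some z \<and> U (F x) z"
      by fastforce
  qed
qed

lemma computable_fun_pair:
  assumes "computable_fun \<rho> D \<mu> F" "computable_fun \<rho> D \<kappa> G"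
  shows "computable_fun \<rho> D (pair_rep \<mu> \<kappa>) (\<lambda>s. (F s, G s))"
proof -
  obtain f where f: "partrec f"
      "\<And>n x. \<rho> n = Some x \<Longrightarrow> x \<in> D \<Longrightarrow> \<exists>m. f n = Some m \<and> \<mu> m = Some (F x)"
    using assms(1) unfolding computable_task_def by blast
  obtain g where g: "partrec g"
      "\<And>n x. \<rho> n = Some x \<Longrightarrow> x \<in> D \<Longrightarrow> \<exists>m. g n = Some m \<and> \<kappa> m = Some (G x)"
    using assms(2) unfolding computable_task_def by blast
  show ?thesis
  proof (rule computable_taskI[OF partrec.pair[OF f(1) g(1)]])
    fix n x assume nx: "\<rho> n = Some x" "x \<in> D"
    obtain m k where "f n = Some m" "\<mu> m = Some (F x)" "g n = Some k" "\<kappa> k = Some (G x)"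
      using f(2)[OF nx] g(2)[OF nx] by blast
    then show "\<exists>m y. Option.bind (f n) (\<lambda>a. Option.bind (g n) (\<lambda>b. Some (prod_encode (a, b))))
        = Some m \<and> pair_rep \<mu> \<kappa> m = Some y \<and> y = (F x, G x)"
      by simp
  qed
qed

lemma computable_fun_id: "computable_fun \<rho> D \<rho> (\<lambda>s. s)"
  by (rule computable_taskI[OF partrec_id]) auto

lemma computable_fun_const:
  assumes "y \<in> ran \<mu>"
  shows "computable_fun \<rho> D \<mu> (\<lambda>s. y)"
proof -
  obtain k where "\<mu> k = Some y" using assms by (auto simp: ran_def)
  then show ?thesis by (intro computable_taskI[OF partrec_const[of k]]) auto
qed

lemma computable_fun_fst: "computable_fun (pair_rep \<mu> \<kappa>) D \<mu> fst"
  by (rule computable_taskI[OF partrec.left]) (auto simp: pair_rep_iff)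

lemma computable_fun_snd: "computable_fun (pair_rep \<mu> \<kappa>) D \<kappa> snd"
  by (rule computable_taskI[OF partrec.right]) (auto simp: pair_rep_iff)

text \<open>Each branch has to halt only on its own part of the domain, because
  \<open>partrec_if\<close> does not run the branch that is not taken.\<close>

lemma computable_task_if:
  assumes "computable_fun \<rho> D bool_rep P"
    and "computable_task \<rho> {s\<in>D. P s} \<mu> T" "computable_task \<rho> {s\<in>D. \<not> P s} \<mu> T"
  shows "computable_task \<rho> D \<mu> T"
proof -
  obtain e where e: "partrec e"
      "\<And>n x. \<rho> n = Some x \<Longrightarrow> x \<in> D \<Longrightarrow> e n = Some (of_bool (P x))"
    using assms(1) unfolding computable_task_def by (auto simp: bool_rep_iff)
  obtain f where f: "partrec f"
      "\<And>n x. \<rho> n = Some x \<Longrightarrow> x \<in> D \<Longrightarrow> P x \<Longrightarrow> \<exists>m y. f n = Some m \<and> \<mu> m = Some y \<and> T x y"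
    using assms(2) unfolding computable_task_def by blast
  obtain g where g: "partrec g"
      "\<And>n x. \<rho> n = Some x \<Longrightarrow> x \<in> D \<Longrightarrow> \<not> P x \<Longrightarrow> \<exists>m y. g n = Some m \<and> \<mu> m = Some y \<and> T x y"
    using assms(3) unfolding computable_task_def by blast
  show ?thesis
  proof (rule computable_taskI[OF partrec_if[OF e(1) g(1) f(1)]])
    fix n x assume nx: "\<rho> n = Some x" "x \<in> D"
    show "\<exists>m y. Option.bind (e n) (\<lambda>b. if b = 0 then g n else f n) = Some m \<and>
        \<mu> m = Some y \<and> T x y"
      using e(2)[OF nx] f(2)[OF nx] g(2)[OF nx] by (cases "P x") auto
  qed
qed

text \<open>Short-circuit evaluation: \<open>Q\<close> is run only after \<open>P\<close> has
  succeeded. Later \<open>P\<close> compares points and so guarantees that the search inside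
  \<open>Q\<close> halts.\<close>

lemma computable_conj:
  assumes "computable_fun \<rho> D bool_rep P" "computable_fun \<rho> {s\<in>D. P s} bool_rep Q"
  shows "computable_fun \<rho> D bool_rep (\<lambda>s. P s \<and> Q s)"
proof (rule computable_task_if[OF assms(1)])
  show "computable_fun \<rho> {s\<in>D. P s} bool_rep (\<lambda>s. P s \<and> Q s)"
    by (rule computable_task_mono[OF assms(2)]) auto
  have "False \<in> ran bool_rep" using bool_rep_simps(1) by (rule ranI)
  from computable_fun_const[OF this]
  show "computable_fun \<rho> {s\<in>D. \<not> P s} bool_rep (\<lambda>s. P s \<and> Q s)"
    by (rule computable_task_mono[where D=UNIV]) auto
qed

lemma computable_not:
  assumes "computable_fun \<rho> D bool_rep P"
  shows "computable_fun \<rho> D bool_rep (\<lambda>s. \<not> P s)"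
proof (rule computable_task_if[OF assms])
  have "False \<in> ran bool_rep" "True \<in> ran bool_rep"
    using ranI[of bool_rep, OF bool_rep_simps(1)] ranI[of bool_rep, OF bool_rep_simps(2)] by auto
  note const = this[THEN computable_fun_const]
  show "computable_fun \<rho> {s\<in>D. P s} bool_rep (\<lambda>s. \<not> P s)"
    by (rule computable_task_mono[OF const(1)[where D=UNIV]]) auto
  show "computable_fun \<rho> {s\<in>D. \<not> P s} bool_rep (\<lambda>s. \<not> P s)"
    by (rule computable_task_mono[OF const(2)[where D=UNIV]]) auto
qed

text \<open>The operator \<open>mu\<close> looks for the value \<open>0\<close>, hence it is applied
  to the negated test. The test halts on every number as long as \<open>s\<close> lies in
  \<open>D\<close>, so the least witness is reached.\<close>

lemma computable_search:
  assumes "computable_fun (pair_rep \<rho> Some) (D \<times> UNIV) bool_rep (\<lambda>(s, n). Q s n)"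
    and "\<And>s. s \<in> D \<Longrightarrow> s \<in> ran \<rho> \<Longrightarrow> \<exists>n. Q s n"
  shows "computable_task \<rho> D Some Q"
proof -
  have "computable_fun (pair_rep \<rho> Some) (D \<times> UNIV) bool_rep (\<lambda>x. \<not> (case x of (s, n) \<Rightarrow> Q s n))"
    by (rule computable_not[OF assms(1)])
  then obtain f where f: "partrec f" "\<And>n x. pair_rep \<rho> Some n = Some x \<Longrightarrow> x \<in> D \<times> UNIV \<Longrightarrow>
      f n = Some (of_bool (\<not> (case x of (s, n) \<Rightarrow> Q s n)))"
    unfolding computable_task_def by (auto simp: bool_rep_iff)
  show ?thesis
  proof (rule computable_taskI[OF partrec.mu[OF f(1)]])
    fix a s assume s: "\<rho> a = Some s" "s \<in> D"
    have fa: "f (prod_encode (a, n)) = Some (of_bool (\<not> Q s n))" for n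
      using f(2)[of "prod_encode (a, n)" "(s, n)"] s by simp
    have "\<exists>n. Q s n" using assms(2) s by (meson ranI)
    then show "\<exists>m y. (if \<exists>n. f (prod_encode (a, n)) = Some 0 \<and>
          (\<forall>k<n. f (prod_encode (a, k)) \<noteq> None)
        then Some (LEAST n. f (prod_encode (a, n)) = Some 0) else None) = Some m \<and>
        Some m = Some y \<and> Q s y"
      by (auto simp: fa intro: LeastI)
  qed
qed

text \<open>The recursion runs on representatives: it starts from one fixed representative of
  \<open>x\<close>, and each step turns a representative of one iterate into some representative of
  the next.\<close>

lemma computable_funpow:
  assumes "computable_fun \<mu> UNIV \<mu> F" "x \<in> ran \<mu>"
  shows "computable_fun Some UNIV \<mu> (\<lambda>n. (F ^^ n) x)"
proof -
  obtain f where f: "partrec f" "\<And>n x. \<mu> n = Some x \<Longrightarrow> \<exists>m. f n = Some m \<and> \<mu> m = Some (F x)"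
    using assms(1) unfolding computable_task_def by blast
  obtain k where k: "\<mu> k = Some x" using assms(2) by (auto simp: ran_def)
  have "partrec (\<lambda>n. f (snd (prod_decode (snd (prod_decode n)))))"
    using partrec.comp[OF f(1) partrec.comp[OF partrec.right partrec.right]] by simp
  from partrec_rec[OF partrec_const[of k] this partrec_id]
  have "partrec (\<lambda>n. rec_nat (Some k) (\<lambda>y r. Option.bind r f) n)" by simp
  then show ?thesis
  proof (rule computable_taskI)
    fix n m :: nat assume "Some n = Some m"
    moreover have "\<exists>l. rec_nat (Some k) (\<lambda>y r. Option.bind r f) n = Some l \<and> \<mu> l = Some ((F ^^ n) x)"
      using f(2) by (induction n) (fastforce simp: k)+
    ultimately show "\<exists>l y. rec_nat (Some k) (\<lambda>y r. Option.bind r f) n = Some l \<and>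
        \<mu> l = Some y \<and> y = (F ^^ m) x" by auto
  qed
qed

text \<open>Minimisation finds the first position that violates \<open>Q\<close> or lies beyond the
  end of the list. All entries satisfy \<open>Q\<close> iff this position lies beyond the
  end.\<close>

lemma computable_list_all:
  assumes "computable_fun (pair_rep \<rho> \<mu>) E bool_rep Q"
  shows "computable_fun (pair_rep \<rho> (list_rep \<mu>)) {(s, xs). \<forall>x\<in>set xs. (s, x) \<in> E} bool_rep
    (\<lambda>(s, xs). \<forall>x\<in>set xs. Q (s, x))"
proof -
  obtain q where q: "partrec q"
      "\<And>n z. pair_rep \<rho> \<mu> n = Some z \<Longrightarrow> z \<in> E \<Longrightarrow> q n = Some (of_bool (Q z))"
    using assms unfolding computable_task_def by (auto simp: bool_rep_iff)
  \<comment> \<open>\<open>tail\<close> and \<open>the_drop\<close> act on \<^const>\<open>list_encode\<close>d lists; as \<open>tail 0 = 0\<close>, no case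
    distinction is needed.\<close>
  define tail where "tail c = snd (prod_decode (c - 1))" for c
  have tail: "list_decode (tail c) = tl (list_decode c)" for c
  proof (cases c)
    case 0
    have "prod_decode 0 = (0, 0)" by (simp add: prod_decode_def prod_decode_aux.simps)
    with 0 show ?thesis by (simp add: tail_def)
  next
    case (Suc d)
    then show ?thesis by (cases "prod_decode d") (simp add: tail_def)
  qed
  define the_drop where "the_drop c i = (tail ^^ i) c" for c i
  have drop: "list_decode (the_drop c i) = drop i (list_decode c)" for c i
    by (induction i) (auto simp: the_drop_def tail drop_Suc tl_drop)
  have zero: "c = 0 \<longleftrightarrow> list_decode c = []" for c
    by (metis list_decode.simps(1) list_encode.simps(1) list_decode_inverse)
  have head: "fst (prod_decode (c - 1)) = hd (list_decode c)" if "c \<noteq> 0" for c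
    using that by (cases c; cases "prod_decode (c - 1)") auto
  have partrec_tail: "partrec (\<lambda>c. Some (tail c))"
    using partrec.comp[OF partrec.right partrec_pred] by (simp add: tail_def)
  have partrec_drop: "partrec (\<lambda>n. Some (the_drop (snd (prod_decode (fst (prod_decode n)))) (snd (prod_decode n))))"
  proof -
    have step: "partrec (\<lambda>n. Some (tail (snd (prod_decode (snd (prod_decode n))))))"
      using partrec.comp[OF partrec_tail partrec.comp[OF partrec.right partrec.right]] by simp
    have base: "partrec (\<lambda>n. Some (snd (prod_decode (fst (prod_decode n)))))"
      using partrec.comp[OF partrec.right partrec.left] by simp
    have "rec_nat (Some c) (\<lambda>y r. Option.bind r (\<lambda>i. Some (tail i))) m = Some (the_drop c m)" for c m
      by (induction m) (auto simp: the_drop_def)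
    with partrec_rec[OF base step partrec.right] show ?thesis by simp
  qed
  \<comment> \<open>The value \<open>0\<close> marks a failing entry as well as the end of the list,
    so the search stops at the length of the list at the latest.\<close>
  define test where "test n = (let c = the_drop (snd (prod_decode (fst (prod_decode n)))) (snd (prod_decode n))
    in if c = 0 then Some 0 else
      q (prod_encode (fst (prod_decode (fst (prod_decode n))), fst (prod_decode (c - 1)))))" for n
  have "partrec test"
  proof -
    have "partrec (\<lambda>n. Some (prod_encode (fst (prod_decode (fst (prod_decode n))),
        fst (prod_decode (the_drop (snd (prod_decode (fst (prod_decode n)))) (snd (prod_decode n)) - 1)))))"
      using partrec.pair[OF partrec.comp[OF partrec.left partrec.left]
          partrec.comp[OF partrec.left partrec.comp[OF partrec_pred partrec_drop]]] by simp
    from partrec_if[OF partrec_drop partrec_const[of 0] partrec.comp[OF q(1) this]]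
    show ?thesis by (simp add: test_def[abs_def] Let_def cong: if_cong)
  qed
  note mu = partrec.mu[OF this]
  define \<phi> where "\<phi> a = (if \<exists>n. test (prod_encode (a, n)) = Some 0 \<and>
          (\<forall>k<n. test (prod_encode (a, k)) \<noteq> None)
        then Some (LEAST n. test (prod_encode (a, n)) = Some 0) else None)" for a
  have "partrec \<phi>" using mu unfolding \<phi>_def[abs_def] .
  from partrec.comp[OF partrec_is_zero partrec.comp[OF partrec_drop partrec.pair[OF partrec_id this]]]
  have "partrec (\<lambda>a. Option.bind (\<phi> a)
      (\<lambda>i. Some (if the_drop (snd (prod_decode a)) i = 0 then 1 else 0)))"
    by (simp add: Option.bind_assoc)
  then show ?thesis
  proof (rule computable_taskI)
    fix a z assume a: "pair_rep \<rho> (list_rep \<mu>) a = Some z"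
      and z: "z \<in> {(s, xs). \<forall>x\<in>set xs. (s, x) \<in> E}"
    obtain s xs where sxs: "z = (s, xs)" by (cases z)
    obtain l c where lc: "prod_decode a = (l, c)" by (cases "prod_decode a")
    have l: "\<rho> l = Some s" and c: "list_all2 (\<lambda>k x. \<mu> k = Some x) (list_decode c) xs"
      using a lc by (auto simp: sxs pair_rep_iff list_rep_iff)
    have len: "length (list_decode c) = length xs" using c by (rule list_all2_lengthD)
    have test: "test (prod_encode (a, i)) =
        (if i < length xs then Some (of_bool (Q (s, xs ! i))) else Some 0)" for i
    proof (cases "i < length xs")
      case True
      then have nz: "the_drop c i \<noteq> 0" by (simp add: zero drop len)
      have "q (prod_encode (l, list_decode c ! i)) = Some (of_bool (Q (s, xs ! i)))"
        using True c z l by (intro q(2)) (auto simp: sxs len list_all2_conv_all_nth)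
      moreover have "fst (prod_decode (the_drop c i - 1)) = list_decode c ! i"
        using True by (simp only: head[OF nz] drop hd_drop_conv_nth len)
      ultimately show ?thesis using True nz by (simp add: test_def lc)
    next
      case False
      then have "the_drop c i = 0" by (simp add: zero drop len)
      with False show ?thesis by (simp add: test_def lc)
    qed
    define i where "i = (LEAST n. test (prod_encode (a, n)) = Some 0)"
    have 0: "test (prod_encode (a, length xs)) = Some 0" by (simp add: test)
    have \<phi>: "\<phi> a = Some i" unfolding \<phi>_def i_def using 0 by (auto simp: test)
    have i: "test (prod_encode (a, i)) = Some 0" unfolding i_def by (rule LeastI[of _ "length xs"]) (rule 0)
    have less: "Q (s, xs ! k)" if "k < i" "k < length xs" for k
      using not_less_Least[OF that(1)[unfolded i_def]] that(2) by (auto simp: test split: if_splits)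
    have "the_drop c i = 0 \<longleftrightarrow> length xs \<le> i" by (simp add: zero drop len)
    also have "\<dots> \<longleftrightarrow> (\<forall>x\<in>set xs. Q (s, x))"
      proof
      assume le: "length xs \<le> i"
      with less show "\<forall>x\<in>set xs. Q (s, x)" by (auto simp: all_set_conv_all_nth)
    next
      assume "\<forall>x\<in>set xs. Q (s, x)"
      with i show "length xs \<le> i" by (auto simp: test split: if_splits)
    qed
    finally show "\<exists>m y. Option.bind (\<phi> a)
        (\<lambda>i. Some (if the_drop (snd (prod_decode a)) i = 0 then 1 else 0)) = Some m \<and>
        bool_rep m = Some y \<and> y = (case z of (s, xs) \<Rightarrow> \<forall>x\<in>set xs. Q (s, x))"
      by (simp add: \<phi> lc sxs)
  qed
qed

lemma computable_task_post:
  assumes "computable_task \<rho> D \<mu> T" "computable_fun \<mu> UNIV \<kappa> G"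
  shows "computable_task \<rho> D \<kappa> (\<lambda>s z. \<exists>y. T s y \<and> y \<in> ran \<mu> \<and> z = G y)"
proof -
  have "computable_fun (pair_rep \<rho> \<mu>) UNIV \<kappa> (\<lambda>p. G (snd p))"
    by (rule computable_task_comp[OF computable_fun_snd assms(2)]) auto
  from computable_task_bind[OF assms(1) this] show ?thesis by simp
qed

lemma computable_fst:
  "computable_fun \<rho> D (pair_rep \<mu> \<kappa>) F \<Longrightarrow> computable_fun \<rho> D \<mu> (\<lambda>s. fst (F s))"
  by (rule computable_task_comp[OF _ computable_fun_fst[where D = UNIV]]) auto

lemma computable_snd:
  "computable_fun \<rho> D (pair_rep \<mu> \<kappa>) F \<Longrightarrow> computable_fun \<rho> D \<kappa> (\<lambda>s. snd (F s))"
  by (rule computable_task_comp[OF _ computable_fun_snd[where D = UNIV]]) auto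

lemma ran_pair_rep: "(x, y) \<in> ran (pair_rep \<mu> \<kappa>) \<longleftrightarrow> x \<in> ran \<mu> \<and> y \<in> ran \<kappa>"
  unfolding ran_def mem_Collect_eq pair_rep_iff by (metis fst_conv snd_conv prod_encode_inverse)

section \<open>The group of piecewise-linear homeomorphisms\<close>

text \<open>HOL-Algebra takes over the notation \<open>inv\<close> for the inverse of a function.\<close>

abbreviation finv :: "('a \<Rightarrow> 'b) \<Rightarrow> 'b \<Rightarrow> 'a" where
  "finv f \<equiv> inv_into UNIV f"

section \<open>Increasing bijections of the line and the group structure\<close>

lemma strict_mono_surj_image_interval:
  fixes f :: "real \<Rightarrow> real"
  assumes "strict_mono f" "surj f"
  shows "f ` {a<..<b} = {f a<..<f b}" "f ` {a..b} = {f a..f b}"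
proof -
  have "y \<in> f ` S \<longleftrightarrow> inv_into UNIV f y \<in> S" for y S
    using inv_f_f[OF strict_mono_imp_inj_on[OF assms(1)]] surj_f_inv_f[OF assms(2)]
    by (auto intro: rev_image_eqI[where x = "finv f y"])
  moreover have "finv f y < x \<longleftrightarrow> y < f x" "finv f y \<le> x \<longleftrightarrow> y \<le> f x"
      "x < finv f y \<longleftrightarrow> f x < y" "x \<le> finv f y \<longleftrightarrow> f x \<le> y" for x y
    using assms strict_mono_less[OF assms(1)] strict_mono_less_eq[OF assms(1)]
    by (metis surj_f_inv_f)+
  ultimately show "f ` {a<..<b} = {f a<..<f b}" "f ` {a..b} = {f a..f b}"
    by (auto simp only: set_eq_iff greaterThanLessThan_iff atLeastAtMost_iff)
qed

text \<open>A discontinuity of an increasing function is a jump, and a jump would leave a gap in the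
  range.\<close>

lemma strict_mono_surj_continuous:
  fixes f :: "real \<Rightarrow> real"
  assumes "strict_mono f" "surj f"
  shows "continuous_on S f"
proof -
  have "continuous_on UNIV f"
    using assms by (intro continuous_onI_mono) (auto simp: strict_mono_less_eq)
  then show ?thesis by (rule continuous_on_subset) simp
qed

lemma strict_mono_inv:
  fixes f :: "real \<Rightarrow> real"
  assumes "strict_mono f" "surj f"
  shows "strict_mono (finv f)"
proof (rule strict_monoI)
  fix x y :: real assume "x < y"
  then show "finv f x < finv f y"
    using strict_mono_less[OF assms(1), of "finv f x" "finv f y"] assms(2) by (simp add: surj_f_inv_f)
qed

definition piecewise_affine :: "(real \<Rightarrow> real) \<Rightarrow> bool" where
  "piecewise_affine g \<longleftrightarrow> (\<exists>B. finite B \<and>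
    (\<forall>a b. {a<..<b} \<subseteq> {0..1} - B \<longrightarrow> (\<exists>m c. \<forall>x\<in>{a<..<b}. g x = m * x + c)))"

text \<open>Elements become increasing bijections of the whole line, for which continuity in both
  directions is automatic; products and inverses then require no topology. From left to right,
  \<open>0\<close> and \<open>1\<close> are fixed because an increasing map of the unit interval
  onto itself has to fix its ends.\<close>

lemma PL_plus_iff:
  "f \<in> PL_plus \<longleftrightarrow> strict_mono f \<and> surj f \<and> (\<forall>x. x \<notin> {0<..<1} \<longrightarrow> f x = x) \<and> piecewise_affine f"
  (is "?L \<longleftrightarrow> ?R")
proof
  assume ?L
  then obtain g where g: "homeomorphism {0..1} {0..1} f g" and mono: "strict_mono_on {0..1} f"
    and off: "\<And>x. x \<notin> {0..1} \<Longrightarrow> f x = x" and pl: "piecewise_affine f"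
    by (auto simp: PL_plus_def piecewise_affine_def)
  have img: "f ` {0..1} = {0..1}" using g by (simp add: homeomorphism_def)
  have le: "f x \<le> f y" if "0 \<le> x" "x \<le> y" "y \<le> 1" for x y
    using strict_mono_on_leD[OF mono] that by simp
  have in01: "0 \<le> f x" "f x \<le> 1" if "0 \<le> x" "x \<le> 1" for x
    using that img by force+
  have "0 \<in> f ` {0..1}" "1 \<in> f ` {0..1}" unfolding img by auto
  then obtain x0 x1 where "x0 \<in> {0..1}" "f x0 = 0" "x1 \<in> {0..1}" "f x1 = 1"
    by (auto simp: image_iff)
  then have ends: "f 0 = 0" "f 1 = 1"
    using le[of 0 x0] le[of x1 1] in01[of 0] in01[of 1] by auto
  have "strict_mono f"
  proof (rule strict_monoI)
    fix x y :: real assume "x < y"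
    consider "x \<in> {0..1}" "y \<in> {0..1}" | "x < 0" "y \<in> {0..1}" | "x \<in> {0..1}" "y > 1"
      | "x \<notin> {0..1}" "y \<notin> {0..1}" using \<open>x < y\<close> by fastforce
    then show "f x < f y"
      using \<open>x < y\<close> mono in01[of x] in01[of y] off[of x] off[of y]
      by cases (auto simp: strict_mono_on_def)
  qed
  moreover have "surj f"
    unfolding surj_def
  proof
    fix y show "\<exists>x. y = f x"
    proof (cases "y \<in> {0..1}")
      case True
      then have "y \<in> f ` {0..1}" unfolding img .
      then show ?thesis by blast
    next
      case False
      then show ?thesis by (metis off)
    qed
  qed
  moreover have "f x = x" if "x \<notin> {0<..<1}" for x
    using that off[of x] ends by (cases "x = 0 \<or> x = 1") auto
  ultimately show ?R using pl by blast
next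
  assume R: ?R
  have cont: "continuous_on {0..1} f" "continuous_on {0..1} (finv f)"
    using R by (auto intro!: strict_mono_surj_continuous strict_mono_inv
        inj_imp_surj_inv strict_mono_imp_inj_on)
  have img: "f ` {0..1} = {0..1}"
    using R strict_mono_surj_image_interval(2)[of f 0 1] by simp
  have "inj f" using R by (auto intro: strict_mono_imp_inj_on)
  then have "homeomorphism {0..1} {0..1} f (finv f)"
    using cont img image_inv_f_f[OF \<open>inj f\<close>, of "{0..1}"] R
    by (auto simp: homeomorphism_def surj_f_inv_f)
  then show ?L
    using R by (auto simp: PL_plus_def piecewise_affine_def strict_mono_on_def strict_mono_def)
qed

lemma PL_plusD:
  assumes "f \<in> PL_plus"
  shows "strict_mono f" "surj f" "inj f" "continuous_on S f" "x \<notin> {0<..<1} \<Longrightarrow> f x = x"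
  using assms by (auto simp: PL_plus_iff strict_mono_imp_inj_on strict_mono_surj_continuous)

lemma PL_less_iff: "f \<in> PL_plus \<Longrightarrow> f x < f y \<longleftrightarrow> x < y"
  and PL_le_iff: "f \<in> PL_plus \<Longrightarrow> f x \<le> f y \<longleftrightarrow> x \<le> y"
  and PL_eq_iff: "f \<in> PL_plus \<Longrightarrow> f x = f y \<longleftrightarrow> x = y"
  by (auto simp: PL_plus_iff strict_mono_less strict_mono_less_eq strict_mono_eq)

text \<open>The exceptional points of the product are those of \<open>f\<close> and the preimages of
  those of \<open>g\<close>. An interval that avoids them is mapped by \<open>f\<close> onto an
  interval on which \<open>g\<close> is affine.\<close>

lemma PL_comp:
  assumes f: "f \<in> PL_plus" and g: "g \<in> PL_plus"
  shows "g \<circ> f \<in> PL_plus"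
proof -
  note fD = PL_plusD[OF f] and gD = PL_plusD[OF g]
  obtain B where B: "finite B"
    "\<And>a b. {a<..<b} \<subseteq> {0..1} - B \<Longrightarrow> \<exists>m c. \<forall>x\<in>{a<..<b}. f x = m * x + c"
    using f by (auto simp: PL_plus_iff piecewise_affine_def)
  obtain D where D: "finite D"
    "\<And>a b. {a<..<b} \<subseteq> {0..1} - D \<Longrightarrow> \<exists>m c. \<forall>x\<in>{a<..<b}. g x = m * x + c"
    using g by (auto simp: PL_plus_iff piecewise_affine_def)
  have "\<exists>m c. \<forall>x\<in>{a<..<b}. (g \<circ> f) x = m * x + c"
    if ab: "{a<..<b} \<subseteq> {0..1} - (B \<union> f -` D)" for a b
  proof -
    obtain m c where mc: "\<And>x. x \<in> {a<..<b} \<Longrightarrow> f x = m * x + c" using ab B(2)[of a b] by blast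
    have "f ` {0..1} = {0..1}"
      using strict_mono_surj_image_interval(2)[OF fD(1,2), of 0 1] fD(5)[of 0] fD(5)[of 1] by simp
    then have "{f a<..<f b} \<subseteq> {0..1} - D"
      unfolding strict_mono_surj_image_interval(1)[OF fD(1,2), symmetric] using ab by blast
    then obtain m' c' where "\<And>x. x \<in> {f a<..<f b} \<Longrightarrow> g x = m' * x + c'" using D(2)[of "f a" "f b"] by blast
    then have "(g \<circ> f) x = (m' * m) * x + (m' * c + c')" if "x \<in> {a<..<b}" for x
    proof -
      have "g (f x) = m' * f x + c'" using \<open>\<And>x. x \<in> {f a<..<f b} \<Longrightarrow> g x = m' * x + c'\<close>[of "f x"] that
        by (simp add: PL_less_iff[OF f])
      then show ?thesis by (simp add: mc[OF that] algebra_simps)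
    qed
    then show ?thesis by blast
  qed
  moreover have "finite (B \<union> f -` D)" using B D fD(3) by (simp add: finite_vimageI)
  ultimately have "piecewise_affine (g \<circ> f)" unfolding piecewise_affine_def by blast
  with fD gD comp_surj[OF fD(2) gD(2)] show ?thesis
    by (simp add: PL_plus_iff strict_mono_def)
qed

text \<open>The exceptional points are the images of those of \<open>f\<close>. An affine piece of
  \<open>f\<close> has nonzero slope because it does not collapse an interval, so its equation can
  be solved for the argument.\<close>

lemma PL_inv:
  assumes f: "f \<in> PL_plus"
  shows "finv f \<in> PL_plus"
proof -
  note fD = PL_plusD[OF f]
  have mono: "strict_mono (finv f)" and surj: "surj (finv f)"
    using strict_mono_inv[OF fD(1,2)] inj_imp_surj_inv[OF fD(3)] by auto
  have fix_pt: "finv f x = x" if "x \<notin> {0<..<1}" for x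
    using fD(3) fD(5)[OF that] by (metis inv_f_f)
  obtain B where B: "finite B"
    "\<And>a b. {a<..<b} \<subseteq> {0..1} - B \<Longrightarrow> \<exists>m c. \<forall>x\<in>{a<..<b}. f x = m * x + c"
    using f by (auto simp: PL_plus_iff piecewise_affine_def)
  have "\<exists>m c. \<forall>x\<in>{a<..<b}. finv f x = m * x + c" if ab: "{a<..<b} \<subseteq> {0..1} - f ` B" for a b
  proof (cases "a < b")
    case True
    have img: "finv f ` {0..1} = {0..1}"
      using strict_mono_surj_image_interval(2)[OF mono surj, of 0 1] fix_pt[of 0] fix_pt[of 1] by simp
    have "{finv f a<..<finv f b} \<subseteq> {0..1} - B"
    proof
      fix y assume "y \<in> {finv f a<..<finv f b}"
      then obtain x where x: "x \<in> {a<..<b}" "y = finv f x"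
        unfolding strict_mono_surj_image_interval(1)[OF mono surj, symmetric] by blast
      then have "f y = x" using fD(2) by (simp add: surj_f_inv_f)
      moreover have "x \<in> {0..1}" "x \<notin> f ` B" using ab x by auto
      moreover from this have "y \<in> finv f ` {0..1}" using x by blast
      ultimately show "y \<in> {0..1} - B" using img by auto
    qed
    then obtain m c where mc: "\<And>x. x \<in> {finv f a<..<finv f b} \<Longrightarrow> f x = m * x + c"
      using B(2)[of "finv f a" "finv f b"] by blast
    have eq: "x = m * finv f x + c" if "x \<in> {a<..<b}" for x
      using mc[of "finv f x"] that mono fD(2) by (simp add: strict_mono_less surj_f_inv_f)
    have "m \<noteq> 0"
    proof
      assume "m = 0"
      then have "x = c" if "x \<in> {a<..<b}" for x using eq[OF that] by simp
      from this[of "(2 * a + b) / 3"] this[of "(a + 2 * b) / 3"] True show False by simp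
    qed
    then have "finv f x = (1 / m) * x + (- c / m)" if "x \<in> {a<..<b}" for x
      using eq[OF that] by (simp add: field_simps)
    then show ?thesis by blast
  qed simp
  moreover have "finite (f ` B)" using B by simp
  ultimately have "piecewise_affine (finv f)" unfolding piecewise_affine_def by blast
  with mono surj fix_pt show ?thesis by (simp add: PL_plus_iff)
qed

lemma PL_id: "id \<in> PL_plus"
proof -
  have "\<forall>x\<in>{a<..<b}. id x = 1 * x + (0::real)" for a b :: real by simp
  then have "piecewise_affine id" unfolding piecewise_affine_def by blast
  then show ?thesis by (simp add: PL_plus_iff strict_mono_def)
qed

lemma PL_group_simps [simp]:
  "carrier PL_group = PL_plus" "g \<otimes>\<^bsub>PL_group\<^esub> h = h \<circ> g" "\<one>\<^bsub>PL_group\<^esub> = id"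
  by (simp_all add: PL_group_def)

interpretation PL: group PL_group
  rewrites "carrier PL_group = PL_plus" and "\<one>\<^bsub>PL_group\<^esub> = id"
    and "\<And>g h. g \<otimes>\<^bsub>PL_group\<^esub> h = h \<circ> g"
proof -
  show "group PL_group"
  proof (rule groupI)
    fix f assume "f \<in> carrier PL_group"
    then show "\<exists>g\<in>carrier PL_group. g \<otimes>\<^bsub>PL_group\<^esub> f = \<one>\<^bsub>PL_group\<^esub>"
      using PL_plusD(2)[of f] by (intro bexI[of _ "finv f"]) (simp_all add: PL_inv surj_iff)
  qed (auto simp: PL_comp PL_id comp_assoc)
qed simp_all

lemma PL_m_inv [simp]: "f \<in> PL_plus \<Longrightarrow> inv\<^bsub>PL_group\<^esub> f = finv f"
  using PL_plusD(2)[of f] by (intro PL.inv_equality) (simp_all add: PL_inv surj_iff)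

lemma PL_inv_simps:
  assumes "f \<in> PL_plus"
  shows "f (finv f x) = x" "finv f (f x) = x"
  using PL_plusD[OF assms] by (simp_all add: surj_f_inv_f)

section \<open>Subgroups, one-bump factors and orbitals\<close>

lemma subgroup_PL_iff:
  "subgroup H PL_group \<longleftrightarrow> H \<subseteq> PL_plus \<and> id \<in> H \<and> (\<forall>f\<in>H. \<forall>g\<in>H. g \<circ> f \<in> H) \<and> (\<forall>f\<in>H. finv f \<in> H)"
  by (auto simp: subgroup_def subset_iff)

text \<open>Since \<open>f\<close> fixes \<open>a\<close> and \<open>b\<close>, it permutes the
  points between them, and cutting it off there leaves a bijection. At most \<open>a\<close> and
  \<open>b\<close> are new exceptional points.\<close>

lemma factor_PL:
  assumes f: "f \<in> PL_plus" and fix_ends: "f a = a" "f b = b"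
  shows "one_bump_factor f {a<..<b} \<in> PL_plus"
proof -
  let ?g = "one_bump_factor f {a<..<b}"
  note fD = PL_plusD[OF f]
  have inside: "f x \<in> {a<..<b} \<longleftrightarrow> x \<in> {a<..<b}" for x
    using PL_less_iff[OF f, of a x] PL_less_iff[OF f, of x b] fix_ends by simp
  have "strict_mono ?g"
  proof (rule strict_monoI)
    fix x y :: real assume "x < y"
    with PL_less_iff[OF f, of x y] inside[of x] inside[of y]
    show "?g x < ?g y" by (auto simp: one_bump_factor_def)
  qed
  moreover have "surj ?g"
    unfolding surj_def
  proof
    fix y show "\<exists>x. y = ?g x"
    proof (cases "y \<in> {a<..<b}")
      case True
      obtain x where "y = f x" using fD(2) by (auto simp: surj_def)
      with True inside show ?thesis by (auto simp: one_bump_factor_def intro!: exI[of _ x])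
    next
      case False
      then show ?thesis by (auto simp: one_bump_factor_def intro!: exI[of _ y])
    qed
  qed
  moreover have "?g x = x" if "x \<notin> {0<..<1}" for x
    using fD(5)[OF that] by (simp add: one_bump_factor_def)
  moreover have "piecewise_affine ?g"
  proof -
    obtain B where B: "finite B"
      "\<And>p q. {p<..<q} \<subseteq> {0..1} - B \<Longrightarrow> \<exists>m c. \<forall>x\<in>{p<..<q}. f x = m * x + c"
      using f by (auto simp: PL_plus_iff piecewise_affine_def)
    have "\<exists>m c. \<forall>x\<in>{p<..<q}. ?g x = m * x + c"
      if pq: "{p<..<q} \<subseteq> {0..1} - (B \<union> {a, b})" for p q
    proof (cases "{p<..<q} \<subseteq> {a<..<b}")
      case True
      obtain m c where "\<forall>x\<in>{p<..<q}. f x = m * x + c" using pq B(2)[of p q] by blast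
      with True show ?thesis by (intro exI[of _ m] exI[of _ c]) (auto simp: one_bump_factor_def)
    next
      case False
      have "a \<notin> {p<..<q}" "b \<notin> {p<..<q}" using pq by auto
      with False have "{p<..<q} \<inter> {a<..<b} = {}" by auto
      then have "\<forall>x\<in>{p<..<q}. ?g x = 1 * x + 0" by (auto simp: one_bump_factor_def)
      then show ?thesis by blast
    qed
    moreover have "finite (B \<union> {a, b})" using B by simp
    ultimately show ?thesis unfolding piecewise_affine_def by blast
  qed
  ultimately show ?thesis by (simp add: PL_plus_iff)
qed

text \<open>An orbital described by its endpoints: two fixed points with none in between. By
  \<open>orbital_interval_iff\<close> this agrees with the connected components of the support, and
  it replaces connectedness by statements on fixed points.\<close>

definition bump_on :: "(real \<Rightarrow> real) \<Rightarrow> real \<Rightarrow> real \<Rightarrow> bool" where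
  "bump_on f x y \<longleftrightarrow> x < y \<and> f x = x \<and> f y = y \<and> (\<forall>z\<in>{x<..<y}. f z \<noteq> z)"

lemma Supp_PL: "f \<in> PL_plus \<Longrightarrow> Supp f = {x. f x \<noteq> x}"
proof -
  assume "f \<in> PL_plus"
  then have "x \<in> {0..1}" if "f x \<noteq> x" for x
    using PL_plusD(5)[of f x] that by (cases "x \<in> {0<..<1}") auto
  then show ?thesis by (auto simp: Supp_def)
qed

text \<open>The endpoints are the nearest fixed points on either side of \<open>z\<close>. They
  exist because the set of fixed points is closed and contains \<open>0\<close> and
  \<open>1\<close>.\<close>

lemma ex_bump_on:
  assumes f: "f \<in> PL_plus" and z: "f z \<noteq> z"
  obtains x y where "bump_on f x y" "z \<in> {x<..<y}"
proof -
  have z01: "0 < z" "z < 1" using PL_plusD(5)[OF f, of z] z by auto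
  have "closed {t. f t = t}"
    using PL_plusD(4)[OF f, of UNIV] by (intro closed_Collect_eq) auto
  then have cl: "closed ({t. f t = t} \<inter> {..z})" "closed ({t. f t = t} \<inter> {z..})"
    by (auto intro: closed_Int)
  have f01: "f 0 = 0" "f 1 = 1" using PL_plusD(5)[OF f] by auto
  define x where "x = Sup ({t. f t = t} \<inter> {..z})"
  define y where "y = Inf ({t. f t = t} \<inter> {z..})"
  have bdd: "bdd_above ({t. f t = t} \<inter> {..z})" "bdd_below ({t. f t = t} \<inter> {z..})"
    by (auto intro: bdd_aboveI[of _ z] bdd_belowI[of _ z])
  have "0 \<in> {t. f t = t} \<inter> {..z}" "1 \<in> {t. f t = t} \<inter> {z..}" using z01 f01 by auto
  then have "x \<in> {t. f t = t} \<inter> {..z}" "y \<in> {t. f t = t} \<inter> {z..}"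
    unfolding x_def y_def using closed_contains_Sup[OF _ bdd(1) cl(1)]
      closed_contains_Inf[OF _ bdd(2) cl(2)] by blast+
  then have x: "f x = x" "x \<le> z" and y: "f y = y" "z \<le> y" by auto
  have "f t \<noteq> t" if "x < t" "t < y" for t
  proof
    assume t: "f t = t"
    show False
    proof (cases "t \<le> z")
      case True
      with t have "t \<le> x" unfolding x_def by (intro cSup_upper) (auto intro: bdd(1))
      with that show False by simp
    next
      case False
      with t have "y \<le> t" unfolding y_def by (intro cInf_lower) (auto intro: bdd(2))
      with that show False by simp
    qed
  qed
  moreover have "x < z" "z < y" using x y z by (auto simp: order_less_le)
  ultimately show thesis using that[of x y] x y by (auto simp: bump_on_def)
qed

text \<open>A larger connected set would contain one of the endpoints, which are fixed and hence not
  in the support.\<close>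

lemma bump_on_imp_orbital:
  assumes f: "f \<in> PL_plus" and b: "bump_on f x y"
  shows "{x<..<y} \<in> orbitals f"
  unfolding orbitals_def in_components_maximal Supp_PL[OF f]
proof (intro conjI allI impI)
  show "{x<..<y} \<noteq> {}" "{x<..<y} \<subseteq> {x. f x \<noteq> x}" "connected {x<..<y}"
    using b by (auto simp: bump_on_def)
  fix D assume D: "D \<noteq> {} \<and> {x<..<y} \<subseteq> D \<and> D \<subseteq> {x. f x \<noteq> x} \<and> connected D"
  have xy: "x < y" "x \<notin> D" "y \<notin> D" using b D by (auto simp: bump_on_def)
  obtain z where z: "x < z" "z < y" using dense[OF xy(1)] by blast
  then have "z \<in> D" using D by auto
  have conn: "t \<in> D" if "u \<in> D" "v \<in> D" "u \<le> t" "t \<le> v" for u v t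
    using D that unfolding connected_iff_interval by blast
  have "D \<subseteq> {x<..<y}"
  proof
    fix w assume "w \<in> D"
    then have "\<not> w \<le> x" "\<not> y \<le> w"
      using conn[of w z x] conn[of z w y] \<open>z \<in> D\<close> xy z by auto
    then show "w \<in> {x<..<y}" by simp
  qed
  with D show "D = {x<..<y}" by auto
qed

lemma orbitals_iff:
  assumes f: "f \<in> PL_plus"
  shows "A \<in> orbitals f \<longleftrightarrow> (\<exists>x y. A = {x<..<y} \<and> bump_on f x y)"
proof
  assume A: "A \<in> orbitals f"
  then obtain z where z: "z \<in> A" "f z \<noteq> z"
    using in_components_nonempty[of A "Supp f"] in_components_subset[of A "Supp f"]
    unfolding orbitals_def Supp_PL[OF f] by blast
  obtain x y where xy: "bump_on f x y" "z \<in> {x<..<y}" using ex_bump_on[OF f z(2)] .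
  have "A = {x<..<y}"
    using bump_on_imp_orbital[OF f xy(1)] A z(1) xy(2) components_nonoverlap[of A "Supp f" "{x<..<y}"]
    unfolding orbitals_def by blast
  with xy show "\<exists>x y. A = {x<..<y} \<and> bump_on f x y" by blast
qed (use bump_on_imp_orbital[OF f] in blast)

lemma greaterThanLessThan_real_eq_iff:
  fixes x y :: real
  assumes "x < y"
  shows "{x<..<y} = {x'<..<y'} \<longleftrightarrow> x = x' \<and> y = y'"
proof
  assume eq: "{x<..<y} = {x'<..<y'}"
  then have "x' < y'" using assms by (metis greaterThanLessThan_empty_iff not_le)
  then show "x = x' \<and> y = y'"
    using arg_cong[OF eq, of Inf] arg_cong[OF eq, of Sup] assms by simp
qed simp

lemma orbital_interval_iff:
  assumes "f \<in> PL_plus"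
  shows "{x<..<y} \<in> orbitals f \<longleftrightarrow> bump_on f x y"
  using orbitals_iff[OF assms] greaterThanLessThan_real_eq_iff by (metis bump_on_def)

text \<open>An element is the product of its one-bump factors. The induction cuts \<open>f\<close>
  down to unions of more and more orbitals; each orbital is invariant under \<open>f\<close> and
  disjoint from the others, so a further orbital contributes one further factor.\<close>

lemma mem_subgroup_if_factors_mem:
  assumes H: "subgroup H PL_group" and f: "f \<in> PL_plus" and fin: "finite (orbitals f)"
    and factors: "\<And>x y. bump_on f x y \<Longrightarrow> one_bump_factor f {x<..<y} \<in> H"
  shows "f \<in> H"
proof -
  have "one_bump_factor f (\<Union>F) \<in> H" if "finite F" "F \<subseteq> orbitals f" for F
    using that
  proof (induction F rule: finite_induct)
    case empty
    then show ?case using H by (auto simp: one_bump_factor_def subgroup_PL_iff id_def)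
  next
    case (insert A F)
    then obtain x y where A: "A = {x<..<y}" "bump_on f x y" using orbitals_iff[OF f] by blast
    have disj: "A \<inter> \<Union>F = {}"
      using insert components_nonoverlap[of A "Supp f"] unfolding orbitals_def by blast
    have inA: "f t \<in> A \<longleftrightarrow> t \<in> A" for t
      using PL_less_iff[OF f, of x t] PL_less_iff[OF f, of t y] A by (simp add: bump_on_def)
    have eq: "one_bump_factor f (\<Union>(insert A F)) = one_bump_factor f (\<Union>F) \<circ> one_bump_factor f A"
      using disj inA by (auto simp: one_bump_factor_def fun_eq_iff)
    have "one_bump_factor f (\<Union>F) \<in> H" "one_bump_factor f A \<in> H"
      using insert factors A by auto
    then show ?case unfolding eq using H[unfolded subgroup_PL_iff] by blast
  qed
  from this[OF fin] have "one_bump_factor f (\<Union>(orbitals f)) \<in> H" by simp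
  moreover have "one_bump_factor f (\<Union>(orbitals f)) = f"
    unfolding orbitals_def Union_components[symmetric] Supp_PL[OF f] by (auto simp: one_bump_factor_def)
  ultimately show ?thesis by simp
qed

text \<open>Serves to carry fixed points over from generators to the group that they
  generate.\<close>

lemma subgroup_pointwise_stabilizer: "subgroup {f \<in> PL_plus. \<forall>x\<in>S. f x = x} PL_group"
  by (auto simp: subgroup_PL_iff PL_id PL_comp PL_inv) (metis PL_inv_simps(2))

section \<open>Breakpoints inside bumps and elements with a single bump\<close>

lemma affine_at_ends:
  fixes g :: "real \<Rightarrow> real"
  assumes "a < b" "continuous_on {a..b} g" "\<And>x. x \<in> {a<..<b} \<Longrightarrow> g x = m * x + k"
  shows "g a = m * a + k" "g b = m * b + k"
proof -
  have cl: "closure {a<..<b} = {a..b}" using \<open>a < b\<close> by simp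
  have "continuous_on {a..b} (\<lambda>x. g x - (m * x + k))" by (intro continuous_intros assms(2))
  then have "g x - (m * x + k) = 0" if "x \<in> {a..b}" for x
    using continuous_constant_on_closure[of "{a<..<b}" "\<lambda>x. g x - (m * x + k)" 0 x] assms(3) that
    unfolding cl by simp
  from this[of a] this[of b] \<open>a < b\<close> show "g a = m * a + k" "g b = m * b + k" by auto
qed

text \<open>The exceptional points are removed one by one. At such a point the two adjacent affine
  pieces agree in value by continuity and in slope by differentiability, so they are given by the
  same formula.\<close>

lemma differentiable_piecewise_affine_imp_affine:
  fixes g :: "real \<Rightarrow> real"
  assumes "finite B" "continuous_on UNIV g"
    and "\<And>p q. {p<..<q} \<subseteq> {a<..<b} - B \<Longrightarrow> \<exists>m k. \<forall>x\<in>{p<..<q}. g x = m * x + k"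
    and "\<And>x. x \<in> {a<..<b} \<Longrightarrow> g differentiable (at x)"
  shows "\<exists>m k. \<forall>x\<in>{a<..<b}. g x = m * x + k"
  using assms(1,3,4)
proof (induction B arbitrary: a b rule: finite_induct)
  case empty
  then show ?case by blast
next
  case (insert p B)
  show ?case
  proof (cases "p \<in> {a<..<b}")
    case False
    show ?thesis
    proof (rule insert.IH[OF insert.prems(1) insert.prems(2)])
      show "{p'<..<q} \<subseteq> {a<..<b} - insert p B" if "{p'<..<q} \<subseteq> {a<..<b} - B" for p' q
        using that False by blast
    qed
  next
    case True
    have sub: "{a<..<p} \<subseteq> {a<..<b} - {p}" "{p<..<b} \<subseteq> {a<..<b} - {p}" using True by auto
    have "\<exists>m k. \<forall>x\<in>{a<..<p}. g x = m * x + k"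
      by (rule insert.IH; rule insert.prems) (use sub in blast)+
    moreover have "\<exists>m k. \<forall>x\<in>{p<..<b}. g x = m * x + k"
      by (rule insert.IH; rule insert.prems) (use sub in blast)+
    ultimately obtain m1 k1 m2 k2 where l: "\<And>x. x \<in> {a<..<p} \<Longrightarrow> g x = m1 * x + k1"
      and r: "\<And>x. x \<in> {p<..<b} \<Longrightarrow> g x = m2 * x + k2" by blast
    have gp: "g p = m1 * p + k1" "g p = m2 * p + k2"
      using affine_at_ends(2)[of a p g m1 k1, OF _ continuous_on_subset[OF assms(2)] l]
        affine_at_ends(1)[of p b g m2 k2, OF _ continuous_on_subset[OF assms(2)] r] True by simp_all
    obtain D where "(g has_real_derivative D) (at p)"
      using insert.prems(2)[OF True] by (auto simp: real_differentiable_def)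
    then have D: "((\<lambda>y. (g y - g p) / (y - p)) \<longlongrightarrow> D) (at_left p)"
      "((\<lambda>y. (g y - g p) / (y - p)) \<longlongrightarrow> D) (at_right p)"
      unfolding has_field_derivative_iff filterlim_at_split by auto
    have "\<forall>\<^sub>F y in at_left p. (g y - g p) / (y - p) = m1"
      using True l unfolding gp(1)
      by (subst eventually_at_left[of a]) (auto intro!: exI[of _ a] simp: divide_simps algebra_simps)
    then have "((\<lambda>y. (g y - g p) / (y - p)) \<longlongrightarrow> m1) (at_left p)"
      by (rule tendsto_eventually)
    then have "D = m1" using D(1) tendsto_unique trivial_limit_at_left_real by blast
    have "\<forall>\<^sub>F y in at_right p. (g y - g p) / (y - p) = m2"
      using True r unfolding gp(2)
      by (subst eventually_at_right[of p b]) (auto intro!: exI[of _ b] simp: divide_simps algebra_simps)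
    then have "((\<lambda>y. (g y - g p) / (y - p)) \<longlongrightarrow> m2) (at_right p)"
      by (rule tendsto_eventually)
    then have "D = m2" using D(2) tendsto_unique trivial_limit_at_right_real by blast
    with \<open>D = m1\<close> gp have "m2 = m1" "k2 = k1" by auto
    with l r gp have "g x = m1 * x + k1" if "x \<in> {a<..<b}" for x
      using that by (cases x p rule: linorder_cases) auto
    then show ?thesis by blast
  qed
qed

text \<open>Without a breakpoint the element would be affine on the orbital with two fixed ends,
  hence the identity there. The lemma supplies a point of the data structure inside an
  orbital.\<close>

lemma ex_breakpoint_in_bump:
  assumes g: "g \<in> PL_plus" and xy: "bump_on g x y"
  shows "\<exists>c\<in>{x<..<y}. c \<in> breakpoints g"
proof (rule ccontr)
  assume no: "\<not> ?thesis"
  have in01: "z \<in> {0<..<1}" if "z \<in> {x<..<y}" for z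
    using that xy PL_plusD(5)[OF g, of z] by (auto simp: bump_on_def)
  obtain B where B: "finite B"
    "\<And>p q. {p<..<q} \<subseteq> {0..1} - B \<Longrightarrow> \<exists>m c. \<forall>x\<in>{p<..<q}. g x = m * x + c"
    using g by (auto simp: PL_plus_iff piecewise_affine_def)
  have "\<exists>m k. \<forall>z\<in>{x<..<y}. g z = m * z + k"
  proof (rule differentiable_piecewise_affine_imp_affine[OF B(1) PL_plusD(4)[OF g]])
    show "\<exists>m k. \<forall>z\<in>{p<..<q}. g z = m * z + k" if "{p<..<q} \<subseteq> {x<..<y} - B" for p q
      by (rule B(2)) (use that in01 in force)
    show "g differentiable (at z)" if "z \<in> {x<..<y}" for z
      using no in01[OF that] that by (auto simp: breakpoints_def)
  qed
  then obtain m k where mk: "\<And>z. z \<in> {x<..<y} \<Longrightarrow> g z = m * z + k" by blast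
  have "x < y" and fixed: "g x = x" "g y = y" using xy by (auto simp: bump_on_def)
  have "x = m * x + k" "y = m * y + k"
    using affine_at_ends[OF \<open>x < y\<close> PL_plusD(4)[OF g] mk] fixed by auto
  then have "(m - 1) * (y - x) = 0" by (simp add: algebra_simps)
  with \<open>x < y\<close> have "m = 1" by simp
  with \<open>x = m * x + k\<close> have "k = 0" by simp
  obtain z where z: "x < z" "z < y" using dense[OF \<open>x < y\<close>] by blast
  with mk[of z] \<open>m = 1\<close> \<open>k = 0\<close> have "g z = z" by simp
  with xy z show False by (auto simp: bump_on_def)
qed

lemma bump_supp_eq:
  assumes f: "f \<in> PL_plus" and orb: "\<exists>A. orbitals f = {A}"
  shows "\<exists>x y. bump_on f x y \<and> bump_supp f = {x<..<y} \<and> (\<forall>z. z \<notin> {x<..<y} \<longrightarrow> f z = z)"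
proof -
  obtain A where A: "orbitals f = {A}" using orb by blast
  then have supp: "bump_supp f = A" by (simp add: bump_supp_def)
  obtain x y where xy: "A = {x<..<y}" "bump_on f x y" using A orbitals_iff[OF f, of A] by blast
  have "f z = z" if "z \<notin> {x<..<y}" for z
  proof (rule ccontr)
    assume "f z \<noteq> z"
    then obtain p q where "bump_on f p q" "z \<in> {p<..<q}" by (rule ex_bump_on[OF f])
    with bump_on_imp_orbital[OF f this(1)] A xy that show False by auto
  qed
  with xy supp show ?thesis by blast
qed

text \<open>If points were moved in both directions, the intermediate value theorem would give a
  fixed point inside the orbital.\<close>

lemma bump_direction:
  assumes f: "f \<in> PL_plus" and xy: "bump_on f x y"
  shows "(\<forall>z\<in>{x<..<y}. z < f z) \<or> (\<forall>z\<in>{x<..<y}. f z < z)"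
proof (rule ccontr)
  assume "\<not> ?thesis"
  then obtain p q where pq: "p \<in> {x<..<y}" "q \<in> {x<..<y}" "f p \<le> p" "q \<le> f q" by force
  have cont: "continuous_on S (\<lambda>z. f z - z)" for S
    by (intro continuous_intros PL_plusD(4)[OF f])
  have "\<exists>z\<in>{x<..<y}. f z - z = 0"
  proof (cases "p \<le> q")
    case True
    then obtain z where "p \<le> z" "z \<le> q" "f z - z = 0"
      using IVT'[of "\<lambda>z. f z - z" p 0 q] cont pq by auto
    with pq show ?thesis by (intro bexI[of _ z]) auto
  next
    case False
    then obtain z where "q \<le> z" "z \<le> p" "f z - z = 0"
      using IVT2'[of "\<lambda>z. f z - z" p 0 q] cont pq by auto
    with pq show ?thesis by (intro bexI[of _ z]) auto
  qed
  with xy show False by (auto simp: bump_on_def)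
qed

section \<open>Extensions by a bump and disjoint unions\<close>

lemma PL_bump_closed:
  assumes f: "f \<in> PL_plus" and b: "f x = x" "f y = y"
  shows "f z \<in> {x<..<y} \<longleftrightarrow> z \<in> {x<..<y}"
  using PL_less_iff[OF f, of x z] PL_less_iff[OF f, of z y] b by simp

lemma subgroup_PL_comp:
  "subgroup H PL_group \<Longrightarrow> f \<in> H \<Longrightarrow> g \<in> H \<Longrightarrow> g \<circ> f \<in> H"
  by (simp add: subgroup_PL_iff)

text \<open>The normalised situation without any computability: \<open>h\<close> moves points up and
  \<open>T\<close> acts inside one fundamental domain of \<open>h\<close>. Taking \<open>T\<close>
  to be a group, not a set of bumps, allows the outcome of an earlier induction step to be plugged
  in.\<close>

locale bump_extension =
  fixes h :: "real \<Rightarrow> real" and a b c :: real and T :: "(real \<Rightarrow> real) set"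
  assumes h: "h \<in> PL_plus"
    and h_off: "\<And>x. x \<notin> {a<..<b} \<Longrightarrow> h x = x"
    and h_up: "\<And>x. x \<in> {a<..<b} \<Longrightarrow> x < h x"
    and c: "c \<in> {a<..<b}"
    and T: "subgroup T PL_group"
    and T_off: "\<And>t x. t \<in> T \<Longrightarrow> x \<notin> {c<..<h c} \<Longrightarrow> t x = x"
begin

text \<open>The intervals \<open>{pw i c..<pw i (h c)}\<close> are the tiles in the names below. As
  \<open>pw i (h c)\<close> equals \<open>pw (i + 1) c\<close>, consecutive tiles are
  adjacent.\<close>

abbreviation pw :: "int \<Rightarrow> real \<Rightarrow> real" where
  "pw i \<equiv> h [^]\<^bsub>PL_group\<^esub> i"

abbreviation extension :: "(real \<Rightarrow> real) set" where
  "extension \<equiv> generate PL_group (insert h T)"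

lemma T_PL: "t \<in> T \<Longrightarrow> t \<in> PL_plus"
  using T by (auto simp: subgroup_PL_iff)

lemma subgroup_extension: "subgroup extension PL_group"
  using T_PL h by (intro PL.generate_is_subgroup) auto

section \<open>Powers of the bump and their tiles\<close>

lemma pw_PL: "pw i \<in> PL_plus"
  by (rule PL.int_pow_closed[OF h])

lemma pw_extension: "pw i \<in> extension"
  by (rule PL.subgroup_int_pow_closed[OF subgroup_extension]) (rule generate.incl, simp)

lemma pw_off: "x \<notin> {a<..<b} \<Longrightarrow> pw i x = x"
  using PL.subgroup_int_pow_closed[OF subgroup_pointwise_stabilizer[of "- {a<..<b}"], of h i] h h_off
  by auto

lemma pw_add: "pw (i + j) x = pw j (pw i x)"
  using PL.int_pow_mult[OF h, of i j] by simp

lemma pw_0 [simp]: "pw 0 x = x"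
  by simp

lemma pw_1: "pw 1 = h"
  using PL.int_pow_1[OF h] by simp

lemma pw_Suc: "pw (i + 1) x = pw i (h x)" "pw (i + 1) x = h (pw i x)"
  using pw_add[of i 1 x] pw_add[of 1 i x] by (simp_all add: pw_1 add.commute)

lemma pw_in: "pw i x \<in> {a<..<b} \<longleftrightarrow> x \<in> {a<..<b}"
  by (rule PL_bump_closed[OF pw_PL]) (simp_all add: pw_off)

lemma pw_less:
  assumes "x \<in> {a<..<b}"
  shows "pw i x < pw j x \<longleftrightarrow> i < j"
proof -
  have less: "pw i x < pw j x" if "i < j" for i j
    using that
  proof (induction j rule: int_gr_induct)
    case base
    show ?case using h_up[of "pw i x"] pw_in assms by (simp add: pw_Suc(2))
  next
    case (step j)
    then show ?case using h_up[of "pw j x"] pw_in assms by (simp add: pw_Suc(2))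
  qed
  then show ?thesis by (metis less_irrefl linorder_less_linear order_less_asym)
qed

lemma pw_le: "x \<in> {a<..<b} \<Longrightarrow> pw i x \<le> pw j x \<longleftrightarrow> i \<le> j"
  using pw_less by (metis not_le)

text \<open>A bounded sequence of iterates would increase to a limit inside \<open>{a<..<b}\<close>,
  and by continuity this limit would be a fixed point of \<open>h\<close>.\<close>

lemma pw_unbounded:
  assumes z: "z \<in> {a<..<b}" and w: "w \<in> {a<..<b}"
  shows "\<exists>n. w < pw (int n) z"
proof (rule ccontr)
  assume "\<not> ?thesis"
  then have bd: "pw (int n) z \<le> w" for n by (simp add: not_less)
  define X where "X n = pw (int n) z" for n
  have "incseq X" unfolding incseq_def X_def by (simp add: pw_le[OF z])
  then obtain L where L: "X \<longlonglongrightarrow> L" "\<And>n. X n \<le> L"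
    using incseq_convergent[of X w] bd by (auto simp: X_def)
  have "L \<le> w" by (rule LIMSEQ_le_const2[OF L(1)]) (simp add: X_def bd)
  moreover have "z \<le> L" using L(2)[of 0] by (simp add: X_def)
  ultimately have "L \<in> {a<..<b}" using z w by auto
  have "isCont h L"
    using PL_plusD(4)[OF h, of UNIV] by (simp add: continuous_on_eq_continuous_at)
  then have "(\<lambda>n. h (X n)) \<longlonglongrightarrow> h L" using L(1) by (rule isCont_tendsto_compose)
  moreover have "h (X n) = X (Suc n)" for n
    unfolding X_def using pw_Suc(2)[of "int n" z] by (simp add: add.commute)
  ultimately have "X \<longlonglongrightarrow> h L" by (simp only: filterlim_sequentially_Suc)
  then have "h L = L" using L(1) by (rule LIMSEQ_unique)
  with h_up[OF \<open>L \<in> {a<..<b}\<close>] show False by simp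
qed

text \<open>Some power moves \<open>z\<close> above \<open>c\<close>; its inverse takes
  \<open>c\<close> to a tile endpoint \<open>d\<close> below \<open>z\<close>. Going up from
  \<open>d\<close>, the first endpoint above \<open>z\<close> closes the tile, and it has a
  predecessor because \<open>d\<close> itself is below \<open>z\<close>.\<close>

lemma tile:
  assumes z: "z \<in> {a<..<b}"
  obtains i where "pw i c \<le> z" "z < pw i (h c)"
proof -
  obtain m where m: "c < pw (int m) z" using pw_unbounded[OF z c] by blast
  define d where "d = pw (- int m) c"
  have "d < pw (- int m) (pw (int m) z)" unfolding d_def using m by (simp add: PL_less_iff[OF pw_PL])
  then have "d < z" unfolding pw_add[symmetric] by simp
  have "d \<in> {a<..<b}" using c by (simp only: d_def pw_in)
  from pw_unbounded[OF this z] obtain n where n: "z < pw (int n) d" by blast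
  define k where "k = (LEAST k. z < pw (int k) d)"
  have k: "z < pw (int k) d" unfolding k_def using n by (rule LeastI)
  with \<open>d < z\<close> have "k \<noteq> 0" by (cases "k = 0") auto
  then obtain l where l: "k = Suc l" by (cases k) auto
  then have "\<not> z < pw (int l) d" unfolding k_def using not_less_Least by (metis lessI)
  moreover have "pw (int k) d = pw (int l - int m) (h c)"
    using pw_add[of "- int m" "int k" c] pw_Suc(1)[of "int l - int m" c] l
    by (simp add: d_def algebra_simps)
  moreover have "pw (int l) d = pw (int l - int m) c"
    using pw_add[of "- int m" "int l" c] by (simp add: d_def algebra_simps)
  ultimately show thesis using that[of "int l - int m"] k by (simp add: not_less)
qed

lemma tile_unique:
  assumes "pw i c \<le> z" "z < pw i (h c)" "pw j c \<le> z" "z < pw j (h c)"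
  shows "i = j"
proof -
  have "\<not> i < j" if "z < pw i (h c)" "pw j c \<le> z" for i j
    using that pw_le[OF c, of "i + 1" j] by (auto simp: pw_Suc(1))
  with assms show ?thesis by (meson linorder_less_linear)
qed

lemma c_less: "c < h c"
  using h_up[OF c] .

lemma hc: "h c \<in> {a<..<b}"
  using pw_in[of 1 c] c by (simp only: pw_1)

lemma T_interval:
  assumes "t \<in> T"
  shows "t x \<in> {c..h c} \<longleftrightarrow> x \<in> {c..h c}" "t c = c" "t (h c) = h c"
    "t x \<in> {c..<h c} \<longleftrightarrow> x \<in> {c..<h c}"
proof -
  show tc: "t c = c" "t (h c) = h c" using T_off[OF assms] by auto
  show "t x \<in> {c..h c} \<longleftrightarrow> x \<in> {c..h c}" "t x \<in> {c..<h c} \<longleftrightarrow> x \<in> {c..<h c}"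
    using PL_le_iff[OF T_PL[OF assms], of c x] PL_le_iff[OF T_PL[OF assms], of x "h c"]
      PL_less_iff[OF T_PL[OF assms], of x "h c"] tc by auto
qed

text \<open>
  Elements of the extension permute the fundamental domains \<open>[h\<^sup>i c, h\<^sup>i\<^sup>+\<^sup>1 c]\<close> by a translation,
  and up to it they act on each of them as an element of \<open>T\<close>.
\<close>

definition shifts :: "(real \<Rightarrow> real) \<Rightarrow> int \<Rightarrow> bool" where
  "shifts w n \<longleftrightarrow> (\<forall>i. \<exists>t\<in>T. \<forall>x\<in>{c..h c}. w (pw i x) = pw (i + n) (t x))"

lemma shiftsE:
  assumes "shifts w n"
  obtains t where "t \<in> T" "\<And>x. x \<in> {c..h c} \<Longrightarrow> w (pw i x) = pw (i + n) (t x)"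
  using assms unfolding shifts_def by meson

text \<open>Only the tile indices need care: in a product the second factor meets the
  \<open>i\<close>-th tile at index \<open>i + n\<close>, and for an inverse the element of
  \<open>T\<close> belonging to index \<open>i - n\<close> is inverted.\<close>

lemma subgroup_shifting:
  "subgroup {w \<in> PL_plus. (\<forall>x. x \<notin> {a<..<b} \<longrightarrow> w x = x) \<and> (\<exists>n. shifts w n)} PL_group"
  (is "subgroup ?W _")
  unfolding subgroup_PL_iff
proof (intro conjI ballI)
  have idT: "id \<in> T" using T by (simp add: subgroup_PL_iff)
  then have "shifts id 0" unfolding shifts_def by (intro allI bexI[of _ id]) auto
  then show "id \<in> ?W" using PL_id by auto
  show "g \<circ> f \<in> ?W" if fg: "f \<in> ?W" "g \<in> ?W" for f g
  proof -
    obtain n m where n: "shifts f n" and m: "shifts g m" using fg by auto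
    have "shifts (g \<circ> f) (n + m)"
      unfolding shifts_def
    proof
      fix i
      obtain t where t: "t \<in> T" "\<And>x. x \<in> {c..h c} \<Longrightarrow> f (pw i x) = pw (i + n) (t x)"
        using shiftsE[OF n, of i] by blast
      obtain s where s: "s \<in> T" "\<And>x. x \<in> {c..h c} \<Longrightarrow> g (pw (i + n) x) = pw (i + n + m) (s x)"
        using shiftsE[OF m, of "i + n"] by blast
      have "s \<circ> t \<in> T" using T t s by (simp add: subgroup_PL_iff)
      moreover have "(g \<circ> f) (pw i x) = pw (i + (n + m)) ((s \<circ> t) x)" if "x \<in> {c..h c}" for x
        using that t(2)[of x] s(2)[of "t x"] T_interval(1)[OF t(1), of x] by (simp add: add.assoc)
      ultimately show "\<exists>t\<in>T. \<forall>x\<in>{c..h c}. (g \<circ> f) (pw i x) = pw (i + (n + m)) (t x)" by blast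
    qed
    then show ?thesis using fg PL_comp by auto
  qed
  show "finv f \<in> ?W" if f: "f \<in> ?W" for f
  proof -
    have fPL: "f \<in> PL_plus" using f by simp
    obtain n where n: "shifts f n" using f by auto
    have "shifts (finv f) (- n)"
      unfolding shifts_def
    proof
      fix i
      obtain t where t: "t \<in> T" "\<And>x. x \<in> {c..h c} \<Longrightarrow> f (pw (i - n) x) = pw (i - n + n) (t x)"
        using shiftsE[OF n, of "i - n"] by blast
      have "finv t \<in> T" using T t(1) by (simp add: subgroup_PL_iff)
      moreover have "finv f (pw i x) = pw (i + - n) (finv t x)" if x: "x \<in> {c..h c}" for x
      proof -
        have tt: "t (finv t x) = x" by (rule PL_inv_simps(1)[OF T_PL[OF t(1)]])
        then have "finv t x \<in> {c..h c}" using T_interval(1)[OF t(1), of "finv t x"] x by simp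
        then have "f (pw (i - n) (finv t x)) = pw i x" using t(2)[of "finv t x"] tt by simp
        then show ?thesis using PL_inv_simps(2)[OF fPL] by (metis diff_conv_add_uminus)
      qed
      ultimately show "\<exists>t\<in>T. \<forall>x\<in>{c..h c}. finv f (pw i x) = pw (i + - n) (t x)" by blast
    qed
    moreover have "finv f x = x" if "x \<notin> {a<..<b}" for x
      using f that PL_inv_simps(2)[OF fPL, of x] by simp
    ultimately show ?thesis using PL_inv[OF fPL] by auto
  qed
qed auto

text \<open>By \<open>subgroup_shifting\<close> it is enough to look at the generators:
  \<open>h\<close> translates by one tile with the identity of \<open>T\<close> everywhere, and an
  element of \<open>T\<close> acts on the tile of index \<open>0\<close> and fixes all others
  pointwise.\<close>

lemma extensionD:
  assumes "w \<in> extension"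
  shows "w \<in> PL_plus" "x \<notin> {a<..<b} \<Longrightarrow> w x = x" "\<exists>n. shifts w n"
proof -
  let ?W = "{w \<in> PL_plus. (\<forall>x. x \<notin> {a<..<b} \<longrightarrow> w x = x) \<and> (\<exists>n. shifts w n)}"
  have idT: "id \<in> T" using T by (simp add: subgroup_PL_iff)
  have "shifts h 1"
    unfolding shifts_def using idT by (intro allI bexI[of _ id]) (simp_all add: pw_Suc(2))
  then have "h \<in> ?W" using h h_off by auto
  moreover have "t \<in> ?W" if t: "t \<in> T" for t
  proof -
    have "\<exists>s\<in>T. \<forall>x\<in>{c..h c}. t (pw i x) = pw (i + 0) (s x)" for i
    proof (cases "i = 0")
      case True
      with t show ?thesis by (intro bexI[of _ t]) auto
    next
      case False
      have "t (pw i x) = pw i x" if "x \<in> {c..h c}" for x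
      proof (rule T_off[OF t])
        have "pw i c \<le> pw i x" "pw i x \<le> pw (i + 1) c"
          using that by (simp_all add: PL_le_iff[OF pw_PL] pw_Suc(1))
        moreover have "pw 1 c \<le> pw i c \<or> pw (i + 1) c \<le> pw 0 c"
          unfolding pw_le[OF c] using False by linarith
        ultimately show "pw i x \<notin> {c<..<h c}" by (auto simp only: pw_1 pw_0 greaterThanLessThan_iff)
      qed
      with idT show ?thesis by (intro bexI[of _ id]) auto
    qed
    then have "shifts t 0" by (simp add: shifts_def)
    moreover have "t x = x" if "x \<notin> {a<..<b}" for x
      using that T_off[OF t, of x] c hc by auto
    ultimately show ?thesis using T_PL[OF t] by auto
  qed
  ultimately have "extension \<subseteq> ?W"
    by (intro PL.generate_subgroup_incl subgroup_shifting) auto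
  with assms have "w \<in> ?W" by blast
  then show "w \<in> PL_plus" "x \<notin> {a<..<b} \<Longrightarrow> w x = x" "\<exists>n. shifts w n" by auto
qed

section \<open>Action on the tiles and factors of elements of the extension\<close>

lemma shifts_c: "shifts w n \<Longrightarrow> w (pw i c) = pw (i + n) c"
proof -
  assume "shifts w n"
  then obtain t where "t \<in> T" "\<And>x. x \<in> {c..h c} \<Longrightarrow> w (pw i x) = pw (i + n) (t x)"
    using shiftsE[of w n i] by blast
  then show ?thesis using T_interval(2)[of t] c_less by simp
qed

lemma shifts_tile:
  assumes w: "shifts w n" and z: "pw i c \<le> z" "z < pw i (h c)"
  shows "pw (i + n) c \<le> w z" "w z < pw (i + n) (h c)"
proof -
  have zz: "z = pw i (pw (- i) z)" unfolding pw_add[symmetric] by simp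
  obtain t where t: "t \<in> T" "\<And>x. x \<in> {c..h c} \<Longrightarrow> w (pw i x) = pw (i + n) (t x)"
    using shiftsE[OF w, of i] by blast
  have "pw (- i) z \<in> {c..<h c}"
    using z zz PL_le_iff[OF pw_PL, of i c "pw (- i) z"] PL_less_iff[OF pw_PL, of i "pw (- i) z" "h c"]
    by simp
  then have "w z = pw (i + n) (t (pw (- i) z))" "t (pw (- i) z) \<in> {c..<h c}"
    using t(2)[of "pw (- i) z"] zz T_interval(4)[OF t(1), of "pw (- i) z"] by auto
  then show "pw (i + n) c \<le> w z" "w z < pw (i + n) (h c)"
    by (simp_all add: PL_le_iff[OF pw_PL] PL_less_iff[OF pw_PL])
qed

text \<open>A fixed point would remain in its tile, but \<open>w\<close> carries the tile of index
  \<open>i\<close> to that of index \<open>i + n\<close>.\<close>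

lemma shifts_nonzero:
  assumes "shifts w n" "n \<noteq> 0" "z \<in> {a<..<b}"
  shows "w z \<noteq> z"
proof
  assume "w z = z"
  obtain i where i: "pw i c \<le> z" "z < pw i (h c)" using tile[OF assms(3)] .
  from shifts_tile[OF assms(1) this] \<open>w z = z\<close> i have "i + n = i" by (intro tile_unique[of _ z]) auto
  with assms(2) show False by simp
qed

text \<open>With translation number \<open>0\<close> all endpoints of tiles are fixed, so no orbital
  can cross one.\<close>

lemma bump_in_tile:
  assumes w: "w \<in> extension" "shifts w 0" and xy: "bump_on w x y"
  obtains i where "pw i c \<le> x" "x < pw i (h c)" "y \<le> pw i (h c)"
proof -
  obtain z where z: "x < z" "z < y" using xy dense[of x y] by (auto simp: bump_on_def)
  then have "w z \<noteq> z" using xy by (simp add: bump_on_def)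
  with extensionD(2)[OF w(1), of z] have "z \<in> {a<..<b}" by blast
  then obtain i where i: "pw i c \<le> z" "z < pw i (h c)" using tile by blast
  have "w (pw i c) = pw i c" "w (pw i (h c)) = pw i (h c)"
    using shifts_c[OF w(2), of i] shifts_c[OF w(2), of "i + 1"] by (simp_all add: pw_Suc(1))
  then have "pw i c \<notin> {x<..<y}" "pw i (h c) \<notin> {x<..<y}" using xy by (auto simp: bump_on_def)
  then show thesis using i z that[of i] by auto
qed

text \<open>If \<open>w\<close> translates, it has no fixed point in \<open>{a<..<b}\<close>, so
  this is its only orbital and \<open>w\<close> is its own factor. Otherwise the orbital lies in a
  single tile, and its factor is a conjugate of a factor of an element of \<open>T\<close>.\<close>

lemma extension_factor_closed:
  assumes closed: "\<And>t x y. t \<in> T \<Longrightarrow> bump_on t x y \<Longrightarrow> one_bump_factor t {x<..<y} \<in> T"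
    and w: "w \<in> extension" and xy: "bump_on w x y"
  shows "one_bump_factor w {x<..<y} \<in> extension"
proof -
  obtain n where n: "shifts w n" using extensionD(3)[OF w] by blast
  show ?thesis
  proof (cases "n = 0")
    case False
    obtain z where z: "x < z" "z < y" using xy dense[of x y] by (auto simp: bump_on_def)
    then have "w z \<noteq> z" using xy by (simp add: bump_on_def)
    with extensionD(2)[OF w, of z] have "z \<in> {a<..<b}" by blast
    moreover have "x \<notin> {a<..<b}" "y \<notin> {a<..<b}"
      using shifts_nonzero[OF n False] xy by (auto simp: bump_on_def)
    ultimately have "{a<..<b} \<subseteq> {x<..<y}" using z by auto
    then have "w z = z" if "z \<notin> {x<..<y}" for z
      using extensionD(2)[OF w, of z] that by blast
    then have "one_bump_factor w {x<..<y} = w"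
      by (simp add: one_bump_factor_def fun_eq_iff)
    with w show ?thesis by simp
  next
    case True
    with n have n: "shifts w 0" by simp
    obtain i where i: "pw i c \<le> x" "x < pw i (h c)" "y \<le> pw i (h c)"
      using bump_in_tile[OF w n xy] .
    obtain t where t: "t \<in> T" "\<And>s. s \<in> {c..h c} \<Longrightarrow> w (pw i s) = pw i (t s)"
      using shiftsE[OF n, of i] by auto
    have up: "pw i (pw (- i) z) = z" and dn: "pw (- i) (pw i z) = z" for z
      unfolding pw_add[symmetric] by simp_all
    \<comment> \<open>The orbital is pulled back to the tile of index \<open>0\<close>, where
      \<open>w\<close> turns into \<open>t\<close>.\<close>
    define p q where "p = pw (- i) x" and "q = pw (- i) y"
    have pq: "pw i p = x" "pw i q = y" by (simp_all add: p_def q_def up)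
    have cpq: "c \<le> p" "q \<le> h c"
      using i pq PL_le_iff[OF pw_PL, of i c p] PL_le_iff[OF pw_PL, of i q "h c"] by auto
    have "p < q" using xy PL_less_iff[OF pw_PL, of i p q] pq by (simp add: bump_on_def)
    have conj: "w (pw i s) = pw i s \<longleftrightarrow> t s = s" if "s \<in> {p..q}" for s
      using that t(2)[of s] cpq PL_eq_iff[OF pw_PL] by auto
    have "bump_on t p q"
      using xy conj[of p] conj[of q] \<open>p < q\<close> pq PL_less_iff[OF pw_PL, of i]
      unfolding bump_on_def using conj by (metis atLeastAtMost_iff greaterThanLessThan_iff less_eq_real_def)
    from closed[OF t(1) this] have "one_bump_factor t {p<..<q} \<in> extension"
      by (intro generate.incl) simp
    then have "pw i \<circ> (one_bump_factor t {p<..<q} \<circ> pw (- i)) \<in> extension"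
      by (intro subgroup_PL_comp[OF subgroup_extension] pw_extension)
    moreover have "pw i \<circ> (one_bump_factor t {p<..<q} \<circ> pw (- i)) = one_bump_factor w {x<..<y}"
    proof
      fix z
      have "pw (- i) z \<in> {p<..<q} \<longleftrightarrow> z \<in> {x<..<y}"
        using PL_less_iff[OF pw_PL, of "- i" x z] PL_less_iff[OF pw_PL, of "- i" z y]
        by (simp add: p_def q_def)
      then show "(pw i \<circ> (one_bump_factor t {p<..<q} \<circ> pw (- i))) z = one_bump_factor w {x<..<y} z"
        using t(2)[of "pw (- i) z"] cpq by (auto simp: one_bump_factor_def up)
    qed
    ultimately show ?thesis by simp
  qed
qed

text \<open>A necessary condition that the algorithm has to test first, since \<open>w c\<close> can
  be located in a tile only if it lies in \<open>{a<..<b}\<close>.\<close>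

lemma extension_c:
  assumes "w \<in> extension"
  shows "w c \<in> {a<..<b}"
proof -
  obtain n where "shifts w n" using extensionD(3)[OF assms] by blast
  from shifts_c[OF this, of 0] show ?thesis using pw_in[of n c] c by simp
qed

lemma pw_inverse: "finv (pw i) = pw (- i)"
  by (simp only: PL.int_pow_neg[OF h] PL_m_inv[OF pw_PL])

text \<open>If \<open>w\<close> is in the extension, the tile containing \<open>w c\<close> reveals
  its translation number. Undoing this translation gives an element that preserves every tile, whose
  orbitals therefore stay away from \<open>a\<close> and \<open>b\<close>. Conversely, the quotient
  is the product of its factors.\<close>

lemma extension_iff:
  assumes closed: "\<And>t x y. t \<in> T \<Longrightarrow> bump_on t x y \<Longrightarrow> one_bump_factor t {x<..<y} \<in> T"
    and w: "w \<in> PL_plus" and i: "pw i c \<le> w c" "w c < pw i (h c)"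
    and fin: "finite (orbitals (finv (pw i) \<circ> w))"
  shows "w \<in> extension \<longleftrightarrow> (\<forall>x y. bump_on (finv (pw i) \<circ> w) x y \<longrightarrow>
    a < x \<and> y < b \<and> one_bump_factor (finv (pw i) \<circ> w) {x<..<y} \<in> extension)"
    (is "_ \<longleftrightarrow> (\<forall>x y. bump_on ?u x y \<longrightarrow> _)")
proof
  assume wE: "w \<in> extension"
  then have uE: "?u \<in> extension"
    unfolding pw_inverse by (intro subgroup_PL_comp[OF subgroup_extension] pw_extension)
  obtain n where n: "shifts w n" using extensionD(3)[OF wE] by blast
  \<comment> \<open>For an element of the extension \<open>w c\<close> is itself the left endpoint
    of a tile, so the index \<open>i\<close> found by locating it has to be
    \<open>n\<close>.\<close>
  have "w c = pw n c" using shifts_c[OF n, of 0] by simp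
  moreover have "pw n c < pw n (h c)" using c_less by (simp add: PL_less_iff[OF pw_PL])
  ultimately have "n = i" using i by (intro tile_unique[of n "w c" i]) auto
  then have uc: "?u c = c"
    using \<open>w c = pw n c\<close> by (simp add: PL_inv_simps[OF pw_PL])
  obtain k where k: "shifts ?u k" using extensionD(3)[OF uE] by blast
  with uc have "k = 0" using shifts_nonzero[OF k _ c] by blast
  with k have k: "shifts ?u 0" by simp
  show "\<forall>x y. bump_on ?u x y \<longrightarrow> a < x \<and> y < b \<and> one_bump_factor ?u {x<..<y} \<in> extension"
  proof (intro allI impI)
    fix x y assume xy: "bump_on ?u x y"
    obtain j where j: "pw j c \<le> x" "y \<le> pw j (h c)" using bump_in_tile[OF uE k xy] by blast
    moreover have "pw j c \<in> {a<..<b}" "pw j (h c) \<in> {a<..<b}" using c hc by (simp_all only: pw_in)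
    ultimately show "a < x \<and> y < b \<and> one_bump_factor ?u {x<..<y} \<in> extension"
      using extension_factor_closed[OF closed uE xy] by auto
  qed
next
  assume R: "\<forall>x y. bump_on ?u x y \<longrightarrow> a < x \<and> y < b \<and> one_bump_factor ?u {x<..<y} \<in> extension"
  have "?u \<in> PL_plus" using w pw_PL by (simp add: pw_inverse PL_comp)
  then have "?u \<in> extension"
    using R by (intro mem_subgroup_if_factors_mem[OF subgroup_extension _ fin]) auto
  then have "pw i \<circ> ?u \<in> extension"
    by (rule subgroup_PL_comp[OF subgroup_extension _ pw_extension])
  moreover have "pw i \<circ> ?u = w" by (simp add: fun_eq_iff PL_inv_simps[OF pw_PL])
  ultimately show "w \<in> extension" by simp
qed

text \<open>If \<open>f\<close> is in the extension, its fixed point \<open>x\<close> in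
  \<open>{a<..<b}\<close> forces translation number \<open>0\<close>, so the orbital stays in the
  tile where it begins, and pulling it back gives an element of \<open>T\<close>. An orbital that
  leaves the tile is rejected by the test for \<open>T\<close>, whose elements are trivial outside
  of \<open>{c<..<h c}\<close>.\<close>

lemma factor_mem_extension_iff:
  assumes u: "u \<in> PL_plus" and xy: "bump_on u x y" "a < x" "y < b"
    and i: "pw i c \<le> x" "x < pw i (h c)"
  defines "f \<equiv> one_bump_factor u {x<..<y}"
  shows "f \<in> extension \<longleftrightarrow> finv (pw i) \<circ> (f \<circ> pw i) \<in> T"
proof
  assume "finv (pw i) \<circ> (f \<circ> pw i) \<in> T"
  then have "finv (pw i) \<circ> (f \<circ> pw i) \<in> extension" by (intro generate.incl) simp
  then have "pw i \<circ> ((finv (pw i) \<circ> (f \<circ> pw i)) \<circ> pw (- i)) \<in> extension"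
    by (rule subgroup_PL_comp[OF subgroup_extension
          subgroup_PL_comp[OF subgroup_extension pw_extension] pw_extension])
  moreover have "pw i \<circ> ((finv (pw i) \<circ> (f \<circ> pw i)) \<circ> pw (- i)) = f"
    by (simp add: fun_eq_iff PL_inv_simps[OF pw_PL] pw_inverse[symmetric])
  ultimately show "f \<in> extension" by simp
next
  assume fE: "f \<in> extension"
  have bump: "bump_on f x y" using xy(1) by (auto simp: bump_on_def f_def one_bump_factor_def)
  obtain n where n: "shifts f n" using extensionD(3)[OF fE] by blast
  have "f x = x" "x \<in> {a<..<b}" using bump xy by (auto simp: bump_on_def)
  then have "n = 0" using shifts_nonzero[OF n] by blast
  with n have n: "shifts f 0" by simp
  obtain j where j: "pw j c \<le> x" "x < pw j (h c)" "y \<le> pw j (h c)"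
    using bump_in_tile[OF fE n bump] .
  have "j = i" using tile_unique j i by blast
  with j have y: "y \<le> pw i (h c)" by simp
  obtain t where t: "t \<in> T" "\<And>s. s \<in> {c..h c} \<Longrightarrow> f (pw i s) = pw i (t s)"
    using shiftsE[OF n, of i] by auto
  have "finv (pw i) \<circ> (f \<circ> pw i) = t"
  proof
    fix s
    show "(finv (pw i) \<circ> (f \<circ> pw i)) s = t s"
    proof (cases "s \<in> {c..h c}")
      case True
      then show ?thesis using t(2) by (simp add: PL_inv_simps[OF pw_PL])
    next
      case False
      then have "pw i s < pw i c \<or> pw i (h c) < pw i s" by (auto simp: PL_less_iff[OF pw_PL])
      then have "f (pw i s) = pw i s" using i y by (auto simp: f_def one_bump_factor_def)
      moreover have "t s = s" using False by (intro T_off[OF t(1)]) auto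
      ultimately show ?thesis by (simp add: PL_inv_simps[OF pw_PL])
    qed
  qed
  with t show "finv (pw i) \<circ> (f \<circ> pw i) \<in> T" by simp
qed

end

text \<open>The set \<open>?W\<close> of elements that fix \<open>a\<close> and \<open>b\<close> and
  restrict to an element of \<open>G1\<close> inside and of \<open>G2\<close> outside is a subgroup
  containing both groups. Orbitals of its elements avoid \<open>a\<close> and \<open>b\<close>, so
  each lies on one side and is an orbital of one of the two restrictions.\<close>

lemma disjoint_union_factor:
  assumes G1: "subgroup G1 PL_group" and G2: "subgroup G2 PL_group"
    and off1: "\<And>g x. g \<in> G1 \<Longrightarrow> x \<notin> {a<..<b} \<Longrightarrow> g x = x"
    and off2: "\<And>g x. g \<in> G2 \<Longrightarrow> x \<in> {a<..<b} \<Longrightarrow> g x = x"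
    and closed1: "\<And>g x y. g \<in> G1 \<Longrightarrow> bump_on g x y \<Longrightarrow> one_bump_factor g {x<..<y} \<in> G1"
    and closed2: "\<And>g x y. g \<in> G2 \<Longrightarrow> bump_on g x y \<Longrightarrow> one_bump_factor g {x<..<y} \<in> G2"
    and "a < b"
    and w: "w \<in> generate PL_group (G1 \<union> G2)" and xy: "bump_on w x y"
  shows "one_bump_factor w {x<..<y} \<in> (if a \<le> x \<and> y \<le> b then G1 else G2)"
proof -
  let ?W = "{w \<in> PL_plus. w a = a \<and> w b = b \<and> one_bump_factor w {a<..<b} \<in> G1 \<and>
    one_bump_factor w (- {a<..<b}) \<in> G2}"
  \<comment> \<open>By assumption \<open>G2\<close> fixes the open interval; the two endpoints
    follow by continuity.\<close>
  have ends: "g a = a \<and> g b = b" if "g \<in> G2" for g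
  proof -
    have gPL: "g \<in> PL_plus" using that G2 by (auto simp: subgroup_PL_iff)
    have fix_mid: "g ((a + b) / 2) = (a + b) / 2" using off2[OF that] \<open>a < b\<close> by simp
    have "continuous_on {a..b} g" by (rule PL_plusD(4)[OF gPL])
    have "closure {a<..<b} = {a..b}" using \<open>a < b\<close> by simp
    moreover have "g x - x = 0" if "x \<in> closure {a<..<b}" for x
      by (rule continuous_constant_on_closure[OF _ _ that])
        (use off2[OF \<open>g \<in> G2\<close>] PL_plusD(4)[OF gPL] in \<open>auto intro!: continuous_intros\<close>)
    ultimately show ?thesis using \<open>a < b\<close> by auto
  qed
  have in_ab: "w z \<in> {a<..<b} \<longleftrightarrow> z \<in> {a<..<b}" if "w \<in> PL_plus" "w a = a" "w b = b" for w z
    by (rule PL_bump_closed[OF that])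
  have "subgroup ?W PL_group"
    unfolding subgroup_PL_iff
  proof (intro conjI ballI)
    have "one_bump_factor id S = id" for S by (auto simp: one_bump_factor_def)
    then show "id \<in> ?W" using G1 G2 PL_id by (simp add: subgroup_PL_iff)
    show "g \<circ> f \<in> ?W" if "f \<in> ?W" "g \<in> ?W" for f g
    proof -
      have "one_bump_factor (g \<circ> f) {a<..<b} = one_bump_factor g {a<..<b} \<circ> one_bump_factor f {a<..<b}"
        "one_bump_factor (g \<circ> f) (- {a<..<b}) = one_bump_factor g (- {a<..<b}) \<circ> one_bump_factor f (- {a<..<b})"
        using in_ab[of f] that by (auto simp: one_bump_factor_def fun_eq_iff)
      with that G1 G2 PL_comp show ?thesis by (simp add: subgroup_PL_iff)
    qed
    show "finv f \<in> ?W" if f: "f \<in> ?W" for f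
    proof -
      have fPL: "f \<in> PL_plus" using f by simp
      have inv_ends: "finv f a = a" "finv f b = b" using f PL_inv_simps(2)[OF fPL] by (metis (mono_tags, lifting) mem_Collect_eq)+
      have inv_factor: "one_bump_factor (finv f) S = finv (one_bump_factor f S)"
        if S: "\<And>z. f z \<in> S \<longleftrightarrow> z \<in> S" for S
      proof (rule sym, rule inv_unique_comp)
        have S': "finv f z \<in> S \<longleftrightarrow> z \<in> S" for z
          using S[of "finv f z"] by (simp add: PL_inv_simps[OF fPL])
        show "one_bump_factor f S \<circ> one_bump_factor (finv f) S = id"
          "one_bump_factor (finv f) S \<circ> one_bump_factor f S = id"
          using S S' by (auto simp: one_bump_factor_def PL_inv_simps[OF fPL])
      qed
      have "one_bump_factor (finv f) {a<..<b} \<in> G1" "one_bump_factor (finv f) (- {a<..<b}) \<in> G2"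
        using in_ab[of f] f G1 G2 by (subst inv_factor; simp add: subgroup_PL_iff)+
      with inv_ends PL_inv[OF fPL] show ?thesis by simp
    qed
  qed auto
  moreover have "G1 \<subseteq> ?W"
  proof
    fix g assume g: "g \<in> G1"
    have "one_bump_factor g {a<..<b} = g" "one_bump_factor g (- {a<..<b}) = id"
      using off1[OF g] by (auto simp: one_bump_factor_def fun_eq_iff)
    with g off1[OF g] G1 G2 show "g \<in> ?W" by (auto simp: subgroup_PL_iff)
  qed
  moreover have "G2 \<subseteq> ?W"
  proof
    fix g assume g: "g \<in> G2"
    have "one_bump_factor g {a<..<b} = id" "one_bump_factor g (- {a<..<b}) = g"
      using off2[OF g] by (auto simp: one_bump_factor_def fun_eq_iff)
    with g ends[OF g] G1 G2 show "g \<in> ?W" by (auto simp: subgroup_PL_iff)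
  qed
  ultimately have "w \<in> ?W" using w PL.generate_subgroup_incl[of "G1 \<union> G2" ?W] by blast
  then have wW: "w a = a" "w b = b" "one_bump_factor w {a<..<b} \<in> G1"
    "one_bump_factor w (- {a<..<b}) \<in> G2" by auto
  have "a \<notin> {x<..<y}" "b \<notin> {x<..<y}" using wW xy by (auto simp: bump_on_def)
  show ?thesis
  proof (cases "a \<le> x \<and> y \<le> b")
    case True
    then have "bump_on (one_bump_factor w {a<..<b}) x y"
      using xy by (auto simp: bump_on_def one_bump_factor_def)
    from closed1[OF wW(3) this]
    have "one_bump_factor (one_bump_factor w {a<..<b}) {x<..<y} \<in> G1" .
    moreover have "one_bump_factor (one_bump_factor w {a<..<b}) {x<..<y} = one_bump_factor w {x<..<y}"
      using True by (auto simp: one_bump_factor_def fun_eq_iff)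
    ultimately show ?thesis using True by simp
  next
    case False
    then have out: "y \<le> a \<or> b \<le> x"
      using \<open>a \<notin> {x<..<y}\<close> \<open>b \<notin> {x<..<y}\<close> \<open>a < b\<close> xy by (auto simp: bump_on_def)
    then have "bump_on (one_bump_factor w (- {a<..<b})) x y"
      using xy by (auto simp: bump_on_def one_bump_factor_def)
    from closed2[OF wW(4) this]
    have "one_bump_factor (one_bump_factor w (- {a<..<b})) {x<..<y} \<in> G2" .
    moreover have "one_bump_factor (one_bump_factor w (- {a<..<b})) {x<..<y} = one_bump_factor w {x<..<y}"
      using out by (auto simp: one_bump_factor_def fun_eq_iff)
    ultimately show ?thesis using False by auto
  qed
qed

section \<open>Decidability of membership\<close>

lemma subgroup_split_group:
  assumes "C \<subseteq> PL_plus"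
  shows "subgroup (split_group C) PL_group"
  unfolding split_group_def
proof (rule PL.generate_is_subgroup, safe)
  fix g A assume "g \<in> C" "A \<in> orbitals g"
  moreover from this assms have "g \<in> PL_plus" by blast
  ultimately show "one_bump_factor g A \<in> PL_plus"
    using orbitals_iff[of g A] by (auto simp: bump_on_def intro: factor_PL)
qed

context computable_subgroup
begin

section \<open>Represented elements and points, and the given processes in functional form\<close>

lemma C_PL: "C \<subseteq> PL_plus"
  using subgroup.subset[OF subgroup_C] by simp

lemma subgroup_ran: "subgroup (ran \<nu>) PL_group"
  using subgroup_split_group[OF C_PL] by (simp add: ran_\<nu>)

lemma ran_PL: "w \<in> ran \<nu> \<Longrightarrow> w \<in> PL_plus"
  using subgroup_ran by (auto simp: subgroup_PL_iff)

lemma bump_ends_ran: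
  assumes "w \<in> ran \<nu>" "bump_on w x y"
  shows "x \<in> ran \<pi>" "y \<in> ran \<pi>"
proof -
  have "{x<..<y} \<in> orbitals w" "x < y"
    using assms orbital_interval_iff[OF ran_PL] by (auto simp: bump_on_def)
  then have "x \<in> orbital_ends w" "y \<in> orbital_ends w"
    unfolding orbital_ends_def by (force intro!: image_eqI[of _ _ "{x<..<y}"])+
  with assms show "x \<in> ran \<pi>" "y \<in> ran \<pi>"
    unfolding ran_\<pi> special_points_def ran_\<nu>[symmetric] by blast+
qed

lemma breakpoint_ran: "w \<in> ran \<nu> \<Longrightarrow> x \<in> breakpoints w \<Longrightarrow> x \<in> ran \<pi>"
  unfolding ran_\<pi> special_points_def ran_\<nu>[symmetric] by blast

lemma orbital_list:
  assumes w: "w \<in> ran \<nu>" and As: "set As = (\<lambda>A. (Inf A, Sup A)) ` orbitals w"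
  shows "set As = {(x, y). bump_on w x y}"
proof -
  have "orbitals w = {{x<..<y} |x y. bump_on w x y}"
    using orbitals_iff[OF ran_PL[OF w]] by blast
  moreover have "(Inf {x<..<y}, Sup {x<..<y}) = (x, y)" if "bump_on w x y" for x y
    using that by (simp add: bump_on_def)
  ultimately show ?thesis unfolding As by (auto simp: image_iff) (metis fst_conv snd_conv)+
qed

text \<open>Read off from the finite list that the process for orbitals returns.\<close>

lemma finite_orbitals:
  assumes "w \<in> ran \<nu>"
  shows "finite (orbitals w)"
proof -
  obtain As where "set As = (\<lambda>A. (Inf A, Sup A)) ` orbitals w"
    using find_orbitals assms unfolding computable_task_def ran_def by fastforce
  from orbital_list[OF assms this] have "finite {(x, y). bump_on w x y}"
    by (metis List.finite_set)
  then have "finite ((\<lambda>(x, y). {x<..<y}) ` {(x, y). bump_on w x y})" by (rule finite_imageI)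
  moreover have "orbitals w \<subseteq> (\<lambda>(x, y). {x<..<y}) ` {(x, y). bump_on w x y}"
    using orbitals_iff[OF ran_PL[OF assms]] by force
  ultimately show ?thesis by (rule finite_subset[rotated])
qed

lemma computable_comp:
  assumes "computable_fun \<rho> D \<nu> F" "computable_fun \<rho> D \<nu> G"
  shows "computable_fun \<rho> D \<nu> (\<lambda>s. G s \<circ> F s)"
proof -
  have "computable_fun (pair_rep \<nu> \<nu>) UNIV \<nu> (\<lambda>p. snd p \<circ> fst p)"
    by (rule computable_task_mono[OF multiply]) (auto split: prod.splits)
  from computable_task_comp[OF computable_fun_pair[OF assms] this] show ?thesis by simp
qed

lemma computable_inv:
  assumes "computable_fun \<rho> D \<nu> F"
  shows "computable_fun \<rho> D \<nu> (\<lambda>s. finv (F s))"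
proof -
  have "computable_fun \<nu> UNIV \<nu> finv"
    by (rule computable_task_mono[OF invert]) (auto simp: ran_PL)
  from computable_task_comp[OF assms this] show ?thesis by simp
qed

lemma computable_apply:
  assumes "computable_fun \<rho> D \<nu> F" "computable_fun \<rho> D \<pi> x"
  shows "computable_fun \<rho> D \<pi> (\<lambda>s. F s (x s))"
proof -
  have "computable_fun (pair_rep \<nu> \<pi>) UNIV \<pi> (\<lambda>p. fst p (snd p))"
    by (rule computable_task_mono[OF apply_element]) (auto split: prod.splits)
  from computable_task_comp[OF computable_fun_pair[OF assms] this] show ?thesis by simp
qed

lemma computable_less:
  assumes "computable_fun \<rho> D \<pi> x" "computable_fun \<rho> D \<pi> y"
  shows "computable_fun \<rho> D bool_rep (\<lambda>s. x s < y s)"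
proof -
  have "computable_fun (pair_rep \<pi> \<pi>) UNIV bool_rep (\<lambda>p. fst p < snd p)"
    by (rule computable_task_mono[OF computable_task_post[OF compare_points computable_fun_fst]])
      (auto split: prod.splits)
  from computable_task_comp[OF computable_fun_pair[OF assms] this] show ?thesis by simp
qed

lemma computable_le:
  assumes "computable_fun \<rho> D \<pi> x" "computable_fun \<rho> D \<pi> y"
  shows "computable_fun \<rho> D bool_rep (\<lambda>s. x s \<le> y s)"
  using computable_not[OF computable_less[OF assms(2,1)]] by (simp add: not_less)

text \<open>The output of \<open>find_factor\<close> is uniquely determined: it is prescribed on the
  orbital, and its support excludes any movement elsewhere.\<close>

lemma computable_factor:
  assumes "computable_fun \<rho> D \<nu> F" "computable_fun \<rho> D \<pi> x" "computable_fun \<rho> D \<pi> y"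
    and bump: "\<And>s. s \<in> D \<Longrightarrow> s \<in> ran \<rho> \<Longrightarrow> bump_on (F s) (x s) (y s)"
  shows "computable_fun \<rho> D \<nu> (\<lambda>s. one_bump_factor (F s) {x s<..<y s})"
proof -
  have "computable_fun (pair_rep (pair_rep \<pi> \<pi>) \<nu>) {((a, b), g). {a<..<b} \<in> orbitals g} \<nu>
    (\<lambda>((a, b), g). one_bump_factor g {a<..<b})"
  proof (rule computable_task_mono[OF computable_task_post[OF find_factor computable_fun_snd]], safe)
    fix a b g a' b' h
    assume h: "((a', b'), h) \<in> ran (pair_rep (pair_rep \<pi> \<pi>) \<nu>)" "\<forall>x\<in>{a<..<b}. h x = g x"
      "Supp h = {a<..<b}"
    then have "h \<in> PL_plus" by (simp add: ran_pair_rep ran_PL)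
    from Supp_PL[OF this] h show "snd ((a', b'), h) = one_bump_factor g {a<..<b}"
      by (auto simp: one_bump_factor_def fun_eq_iff)
  qed
  from computable_task_comp[OF computable_fun_pair[OF computable_fun_pair[OF assms(2,3)] assms(1)] this]
  show ?thesis
    using bump by (auto simp: ran_pair_rep orbital_interval_iff[OF ran_PL])
qed

lemma computable_all_bumps:
  assumes "computable_fun (pair_rep \<nu> (pair_rep \<pi> \<pi>)) {(w, x, y). bump_on w x y} bool_rep Q"
  shows "computable_fun \<nu> UNIV bool_rep (\<lambda>w. \<forall>x y. bump_on w x y \<longrightarrow> Q (w, x, y))"
proof (rule computable_task_mono[OF computable_task_bind[OF find_orbitals computable_list_all[OF assms]]])
  fix w As
  assume "w \<in> ran \<nu>" and "set As = (\<lambda>A. (Inf A, Sup A)) ` orbitals w \<and>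
    sorted_wrt (\<lambda>(a, _) (a', _). a < a') As"
  then have "set As = {(x, y). bump_on w x y}" by (intro orbital_list) auto
  then show "(w, As) \<in> {(s, xs). \<forall>x\<in>set xs. (s, x) \<in> {(w, x, y). bump_on w x y}}"
    by auto
next
  fix w b assume "w \<in> ran \<nu>"
  assume "\<exists>As. (set As = (\<lambda>A. (Inf A, Sup A)) ` orbitals w \<and>
      sorted_wrt (\<lambda>(a, _) (a', _). a < a') As) \<and> As \<in> ran (list_rep (pair_rep \<pi> \<pi>)) \<and>
      b = (case (w, As) of (s, xs) \<Rightarrow> \<forall>x\<in>set xs. Q (s, x))"
  then obtain As where As: "set As = (\<lambda>A. (Inf A, Sup A)) ` orbitals w"
    and b: "b = (\<forall>p\<in>set As. Q (w, p))"
    unfolding prod.case by blast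
  show "b = (\<forall>x y. bump_on w x y \<longrightarrow> Q (w, x, y))"
    unfolding b orbital_list[OF \<open>w \<in> ran \<nu>\<close> As] by auto
qed auto

text \<open>The good subgroups of the overview. Here \<open>UNIV\<close> amounts to all of
  \<open>S(C)\<close>, the range of \<open>\<nu>\<close>; the tests are applied to factors and
  conjugates of the input, which may lie outside of \<open>C\<close>.\<close>

definition splits_decidably :: "(real \<Rightarrow> real) set \<Rightarrow> bool" where
  "splits_decidably H \<longleftrightarrow> subgroup H PL_group \<and> H \<subseteq> ran \<nu> \<and>
    (\<forall>f\<in>H. \<forall>x y. bump_on f x y \<longrightarrow> one_bump_factor f {x<..<y} \<in> H) \<and>
    computable_fun \<nu> UNIV bool_rep (\<lambda>w. w \<in> H)"

text \<open>The identity is the only element without orbitals, so the test that fails on every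
  orbital decides membership.\<close>

lemma splits_decidably_trivial: "splits_decidably {id}"
proof -
  have id: "id \<in> ran \<nu>" using subgroup_ran by (simp add: subgroup_PL_iff)
  have sub: "subgroup {id} PL_group" by (simp add: subgroup_PL_iff PL_id)
  have "False \<in> ran bool_rep" using bool_rep_simps(1) by (rule ranI)
  from computable_all_bumps[OF computable_fun_const[OF this]]
  have "computable_fun \<nu> UNIV bool_rep (\<lambda>w. w \<in> {id})"
  proof (rule computable_task_mono)
    fix w b assume w: "w \<in> ran \<nu>" and b: "b = (\<forall>x y. bump_on w x y \<longrightarrow> False)"
    have "w = id" if "\<forall>x y. \<not> bump_on w x y"
      using mem_subgroup_if_factors_mem[OF sub ran_PL[OF w] finite_orbitals[OF w]] that by blast
    moreover have "\<not> bump_on id x y" for x y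
      using dense[of x y] by (auto simp: bump_on_def)
    ultimately show "b = (w \<in> {id})" using b by auto
  qed auto
  moreover have "\<not> bump_on id x y" for x y
    using dense[of x y] by (auto simp: bump_on_def)
  ultimately show ?thesis using id sub by (auto simp: splits_decidably_def)
qed

text \<open>Comparing the ends of an orbital with \<open>a\<close> and \<open>b\<close> selects the
  group in which its factor is tested. By \<open>disjoint_union_factor\<close> no element of the
  generated group is rejected, and an element whose factors all pass is their product.\<close>

lemma splits_decidably_disjoint:
  assumes G1: "splits_decidably G1" and G2: "splits_decidably G2" and "a < b"
    and ab: "a \<in> ran \<pi>" "b \<in> ran \<pi>"
    and off: "\<And>g x. g \<in> G1 \<Longrightarrow> x \<notin> {a<..<b} \<Longrightarrow> g x = x"
      "\<And>g x. g \<in> G2 \<Longrightarrow> x \<in> {a<..<b} \<Longrightarrow> g x = x"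
  shows "splits_decidably (generate PL_group (G1 \<union> G2))"
proof -
  let ?H = "generate PL_group (G1 \<union> G2)"
  have sub: "subgroup G1 PL_group" "subgroup G2 PL_group"
    using G1 G2 by (auto simp: splits_decidably_def)
  have H: "subgroup ?H PL_group"
    using sub by (intro PL.generate_is_subgroup) (auto simp: subgroup_PL_iff)
  have "?H \<subseteq> ran \<nu>"
    using G1 G2 by (intro PL.generate_subgroup_incl subgroup_ran) (auto simp: splits_decidably_def)
  have incl: "G1 \<subseteq> ?H" "G2 \<subseteq> ?H" by (auto intro: generate.incl)
  have factor: "one_bump_factor w {x<..<y} \<in> (if a \<le> x \<and> y \<le> b then G1 else G2)"
    if "w \<in> ?H" "bump_on w x y" for w x y
    by (rule disjoint_union_factor[OF sub, where a = a and b = b])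
      (use off G1 G2 \<open>a < b\<close> that in \<open>simp_all add: splits_decidably_def\<close>)
  define Q where "Q p = (one_bump_factor (fst p) {fst (snd p)<..<snd (snd p)} \<in>
    (if a \<le> fst (snd p) \<and> snd (snd p) \<le> b then G1 else G2))" for p :: "(real \<Rightarrow> real) \<times> real \<times> real"
  have "computable_fun (pair_rep \<nu> (pair_rep \<pi> \<pi>)) {(w, x, y). bump_on w x y} bool_rep Q"
  proof (rule computable_task_if)
    let ?\<rho> = "pair_rep \<nu> (pair_rep \<pi> \<pi>)"
    have proj: "computable_fun ?\<rho> D \<nu> (\<lambda>p. fst p)" "computable_fun ?\<rho> D \<pi> (\<lambda>p. fst (snd p))"
      "computable_fun ?\<rho> D \<pi> (\<lambda>p. snd (snd p))" for D
      by (rule computable_fun_fst computable_fst[OF computable_fun_snd] computable_snd[OF computable_fun_snd])+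
    have const: "computable_fun ?\<rho> D \<pi> (\<lambda>p. a)" "computable_fun ?\<rho> D \<pi> (\<lambda>p. b)" for D
      using ab by (auto intro: computable_fun_const)
    show "computable_fun ?\<rho> {(w, x, y). bump_on w x y} bool_rep
        (\<lambda>p. a \<le> fst (snd p) \<and> snd (snd p) \<le> b)"
      by (intro computable_conj computable_le proj const)
    have mem: "computable_fun ?\<rho> D bool_rep
        (\<lambda>p. one_bump_factor (fst p) {fst (snd p)<..<snd (snd p)} \<in> G)"
      if "splits_decidably G" "D \<subseteq> {(w, x, y). bump_on w x y}" for G D
    proof -
      have "computable_fun ?\<rho> D \<nu> (\<lambda>p. one_bump_factor (fst p) {fst (snd p)<..<snd (snd p)})"
        by (rule computable_factor[OF proj]) (use that in auto)
      moreover have "computable_fun \<nu> UNIV bool_rep (\<lambda>w. w \<in> G)"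
        using that by (simp add: splits_decidably_def)
      ultimately show ?thesis by (rule computable_task_comp) simp
    qed
    show "computable_fun ?\<rho> {p \<in> {(w, x, y). bump_on w x y}. a \<le> fst (snd p) \<and> snd (snd p) \<le> b}
        bool_rep Q"
      by (rule computable_task_mono[OF mem[OF G1, of "{p \<in> {(w, x, y). bump_on w x y}. a \<le> fst (snd p) \<and> snd (snd p) \<le> b}"]])
        (auto simp: Q_def)
    show "computable_fun ?\<rho> {p \<in> {(w, x, y). bump_on w x y}. \<not> (a \<le> fst (snd p) \<and> snd (snd p) \<le> b)}
        bool_rep Q"
      by (rule computable_task_mono[OF mem[OF G2, of "{p \<in> {(w, x, y). bump_on w x y}. \<not> (a \<le> fst (snd p) \<and> snd (snd p) \<le> b)}"]])
        (auto simp: Q_def)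
  qed
  from computable_all_bumps[OF this]
  have "computable_fun \<nu> UNIV bool_rep (\<lambda>w. w \<in> ?H)"
  proof (rule computable_task_mono)
    fix w v assume w: "w \<in> ran \<nu>" and v: "v = (\<forall>x y. bump_on w x y \<longrightarrow> Q (w, x, y))"
    have "w \<in> ?H" if "\<forall>x y. bump_on w x y \<longrightarrow> Q (w, x, y)"
    proof (rule mem_subgroup_if_factors_mem[OF H ran_PL[OF w] finite_orbitals[OF w]])
      fix x y assume "bump_on w x y"
      with that have "one_bump_factor w {x<..<y} \<in> G1 \<union> G2" by (auto simp: Q_def split: if_splits)
      then show "one_bump_factor w {x<..<y} \<in> ?H" by (rule generate.incl)
    qed
    moreover have "Q (w, x, y)" if "w \<in> ?H" "bump_on w x y" for x y
      using factor[OF that] by (simp only: Q_def fst_conv snd_conv)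
    ultimately show "v = (w \<in> ?H)" using v by blast
  qed auto
  moreover have "one_bump_factor f {x<..<y} \<in> ?H" if "f \<in> ?H" "bump_on f x y" for f x y
    using factor[OF that] incl by (auto split: if_splits)
  ultimately show ?thesis using H \<open>?H \<subseteq> ran \<nu>\<close> by (auto simp: splits_decidably_def)
qed

end

section \<open>Deciding membership in an extension\<close>

locale computable_bump_extension = computable_subgroup C \<nu> \<pi> \<sigma> + bump_extension h a b c T
  for C \<nu> \<pi> \<sigma> h a b c T +
  assumes h_ran: "h \<in> ran \<nu>" and abc_ran: "a \<in> ran \<pi>" "b \<in> ran \<pi>" "c \<in> ran \<pi>"
    and T_splits: "splits_decidably T"
begin

text \<open>An integer exponent is coded as the difference of a pair of naturals, so that a search
  through the naturals meets all powers of \<open>h\<close>.\<close>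

lemma computable_power: "computable_fun Some UNIV \<nu> (\<lambda>n. pw (int (fst (prod_decode n)) - int (snd (prod_decode n))))"
proof -
  have id: "id \<in> ran \<nu>" using subgroup_ran by (simp add: subgroup_PL_iff)
  have "computable_fun \<nu> UNIV \<nu> (\<lambda>g. h \<circ> g)"
    by (intro computable_comp computable_fun_id computable_fun_const h_ran)
  from computable_funpow[OF this id]
  have "computable_fun Some UNIV \<nu> (\<lambda>n. ((\<circ>) h ^^ n) id)" .
  moreover have "((\<circ>) h ^^ n) id = pw (int n)" for n
  proof (induction n)
    case (Suc n)
    have "int (Suc n) = int n + 1" by simp
    then have "pw (int (Suc n)) x = h (pw (int n) x)" for x by (simp only: pw_Suc(2))
    with Suc show ?case by (simp add: fun_eq_iff)
  qed simp
  ultimately have pow: "computable_fun Some UNIV \<nu> (\<lambda>n. pw (int n))" by simp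
  \<comment> \<open>A number already represents the pair that it encodes, so decoding is the
    identity on representatives.\<close>
  have dec: "computable_fun Some UNIV (pair_rep Some Some) prod_decode"
    by (rule computable_taskI[OF partrec_id]) (auto simp: pair_rep_def)
  have p: "computable_fun Some UNIV \<nu> (\<lambda>n. pw (int (fst (prod_decode n))))"
    by (rule computable_task_comp[OF computable_fst[OF dec] pow]) simp
  have q: "computable_fun Some UNIV \<nu> (\<lambda>n. pw (int (snd (prod_decode n))))"
    by (rule computable_task_comp[OF computable_snd[OF dec] pow]) simp
  have "pw (i - j) = finv (pw j) \<circ> pw i" for i j
  proof
    fix x
    show "pw (i - j) x = (finv (pw j) \<circ> pw i) x"
      using pw_add[of i "- j" x] unfolding pw_inverse by (simp only: diff_conv_add_uminus comp_apply)
  qed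
  with computable_comp[OF p computable_inv[OF q]] show ?thesis by (simp only:)
qed

text \<open>The search ends by \<open>tile\<close>, and its test compares only represented points,
  as \<open>c\<close> is represented and so are its images. The power of \<open>h\<close> itself is
  returned and not its exponent, because later computations only multiply by it.\<close>

lemma computable_tile:
  "computable_task \<pi> {a<..<b} \<nu> (\<lambda>z e. \<exists>i. e = pw i \<and> pw i c \<le> z \<and> z < pw i (h c))"
proof -
  let ?e = "\<lambda>n. pw (int (fst (prod_decode n)) - int (snd (prod_decode n)))"
  have "computable_task \<pi> {a<..<b} Some (\<lambda>z n. ?e n c \<le> z \<and> z < ?e n (h c))"
  proof (rule computable_search)
    let ?\<rho> = "pair_rep \<pi> (Some :: nat \<Rightarrow> nat option)"
    have e: "computable_fun ?\<rho> D \<nu> (\<lambda>p. ?e (snd p))" for D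
      by (rule computable_task_comp[OF computable_fun_snd computable_power]) auto
    note const_c = computable_fun_const[OF abc_ran(3)]
    note const_hc = computable_apply[OF computable_fun_const[OF h_ran] const_c]
    have "computable_fun ?\<rho> ({a<..<b} \<times> UNIV) bool_rep
        (\<lambda>p. ?e (snd p) c \<le> fst p \<and> fst p < ?e (snd p) (h c))"
      by (rule computable_conj[OF computable_le[OF computable_apply[OF e const_c] computable_fun_fst]
            computable_less[OF computable_fun_fst computable_apply[OF e const_hc]]])
    then show "computable_fun ?\<rho> ({a<..<b} \<times> UNIV) bool_rep
        (\<lambda>(z, n). ?e n c \<le> z \<and> z < ?e n (h c))" by (simp add: case_prod_beta')
    fix z assume "z \<in> {a<..<b}"
    then obtain i where i: "pw i c \<le> z" "z < pw i (h c)" using tile by blast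
    have "i = int (nat i) - int (nat (- i))" by simp
    with i show "\<exists>n. ?e n c \<le> z \<and> z < ?e n (h c)"
      by (intro exI[of _ "prod_encode (nat i, nat (- i))"]) simp
  qed
  from computable_task_post[OF this computable_power] show ?thesis
    by (rule computable_task_mono) auto
qed

text \<open>The comparison with \<open>a\<close> and \<open>b\<close> comes first: it places
  \<open>x\<close> in the domain where the search for a tile halts. Conjugation by the power found
  then reduces the question to \<open>T\<close> by \<open>factor_mem_extension_iff\<close>.\<close>

lemma computable_factor_mem:
  "computable_fun (pair_rep \<nu> (pair_rep \<pi> \<pi>)) {(w, x, y). bump_on w x y} bool_rep
    (\<lambda>(w, x, y). a < x \<and> y < b \<and> one_bump_factor w {x<..<y} \<in> extension)"
proof -
  let ?\<rho> = "pair_rep \<nu> (pair_rep \<pi> \<pi>)" and ?D = "{(w, x, y). bump_on w x y}"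
  let ?D' = "{p \<in> ?D. a < fst (snd p) \<and> snd (snd p) < b}"
  have proj: "computable_fun ?\<rho> D \<nu> (\<lambda>p. fst p)" "computable_fun ?\<rho> D \<pi> (\<lambda>p. fst (snd p))"
    "computable_fun ?\<rho> D \<pi> (\<lambda>p. snd (snd p))" for D
    by (rule computable_fun_fst computable_fst[OF computable_fun_snd] computable_snd[OF computable_fun_snd])+
  have inside: "computable_fun ?\<rho> ?D bool_rep (\<lambda>p. a < fst (snd p) \<and> snd (snd p) < b)"
    by (intro computable_conj computable_less proj computable_fun_const abc_ran)
  have search: "computable_task ?\<rho> ?D' \<nu>
      (\<lambda>p e. \<exists>i. e = pw i \<and> pw i c \<le> fst (snd p) \<and> fst (snd p) < pw i (h c))"
    by (rule computable_task_comp[OF proj(2) computable_tile]) (auto simp: bump_on_def)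
  have "computable_fun (pair_rep ?\<rho> \<nu>) {q. bump_on (fst (fst q)) (fst (snd (fst q))) (snd (snd (fst q)))} \<nu>
      (\<lambda>q. finv (snd q) \<circ> (one_bump_factor (fst (fst q)) {fst (snd (fst q))<..<snd (snd (fst q))} \<circ> snd q))"
  proof (rule computable_comp[OF computable_comp[OF computable_fun_snd] computable_inv[OF computable_fun_snd]])
    note w = computable_fst[OF computable_fun_fst]
    note xy = computable_snd[OF computable_fun_fst]
    show "computable_fun (pair_rep ?\<rho> \<nu>) {q. bump_on (fst (fst q)) (fst (snd (fst q))) (snd (snd (fst q)))} \<nu>
      (\<lambda>q. one_bump_factor (fst (fst q)) {fst (snd (fst q))<..<snd (snd (fst q))})"
      by (rule computable_factor[OF w computable_fst[OF xy] computable_snd[OF xy]]) simp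
  qed
  moreover have "computable_fun \<nu> UNIV bool_rep (\<lambda>w. w \<in> T)"
    using T_splits by (simp add: splits_decidably_def)
  ultimately have "computable_fun (pair_rep ?\<rho> \<nu>) {q. bump_on (fst (fst q)) (fst (snd (fst q))) (snd (snd (fst q)))} bool_rep
      (\<lambda>q. finv (snd q) \<circ> (one_bump_factor (fst (fst q)) {fst (snd (fst q))<..<snd (snd (fst q))} \<circ> snd q) \<in> T)"
    by (rule computable_task_comp) simp
  note computable_task_bind[OF search this]
  then have "computable_fun ?\<rho> ?D' bool_rep
      (\<lambda>p. one_bump_factor (fst p) {fst (snd p)<..<snd (snd p)} \<in> extension)"
  proof (rule computable_task_mono)
    fix p v
    assume p: "p \<in> ?D'" "p \<in> ran ?\<rho>" and v: "\<exists>e. (\<exists>i. e = pw i \<and> pw i c \<le> fst (snd p) \<and> fst (snd p) < pw i (h c)) \<and>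
      e \<in> ran \<nu> \<and> v = (finv (snd (p, e)) \<circ> (one_bump_factor (fst (fst (p, e)))
        {fst (snd (fst (p, e)))<..<snd (snd (fst (p, e)))} \<circ> snd (p, e)) \<in> T)"
    obtain w x y where wxy: "p = (w, x, y)" by (cases p)
    with p have "w \<in> PL_plus" "bump_on w x y" "a < x" "y < b" by (auto simp: ran_pair_rep ran_PL)
    then show "v = (one_bump_factor (fst p) {fst (snd p)<..<snd (snd p)} \<in> extension)"
      using v factor_mem_extension_iff[of w x y] wxy by auto
  qed auto
  from computable_conj[OF inside this] show ?thesis
    by (rule computable_task_mono) auto
qed

text \<open>The algorithm tests whether \<open>w c\<close> lies between \<open>a\<close> and
  \<open>b\<close>, locates its tile, divides \<open>w\<close> by the power found and tests every
  orbital of the quotient. It is correct by \<open>extension_iff\<close>, whichever suitable power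
  the search returns.\<close>

lemma splits_decidably_extension: "splits_decidably extension"
proof -
  have closed: "one_bump_factor t {x<..<y} \<in> T" if "t \<in> T" "bump_on t x y" for t x y
    using that T_splits by (auto simp: splits_decidably_def)
  have incl: "extension \<subseteq> ran \<nu>"
    using h_ran T_splits by (intro PL.generate_subgroup_incl subgroup_ran) (auto simp: splits_decidably_def)
  let ?R = "\<lambda>u. \<forall>x y. bump_on u x y \<longrightarrow> a < x \<and> y < b \<and> one_bump_factor u {x<..<y} \<in> extension"
  have R: "computable_fun \<nu> UNIV bool_rep ?R"
    using computable_all_bumps[OF computable_factor_mem] by simp
  have wc: "computable_fun \<nu> D \<pi> (\<lambda>w. w c)" for D
    by (rule computable_apply[OF computable_fun_id computable_fun_const[OF abc_ran(3)]])
  have "computable_fun \<nu> UNIV bool_rep (\<lambda>w. a < w c \<and> w c < b)"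
    by (intro computable_conj computable_less wc computable_fun_const abc_ran)
  moreover have "computable_fun \<nu> {w \<in> UNIV. a < w c \<and> w c < b} bool_rep (\<lambda>w. w \<in> extension)"
  proof -
    have search: "computable_task \<nu> {w \<in> UNIV. a < w c \<and> w c < b} \<nu>
        (\<lambda>w e. \<exists>i. e = pw i \<and> pw i c \<le> w c \<and> w c < pw i (h c))"
      by (rule computable_task_comp[OF wc computable_tile]) auto
    have "computable_fun (pair_rep \<nu> \<nu>) UNIV \<nu> (\<lambda>p. finv (snd p) \<circ> fst p)"
      by (intro computable_comp computable_inv computable_fun_fst computable_fun_snd)
    from computable_task_comp[OF this R]
    have "computable_fun (pair_rep \<nu> \<nu>) UNIV bool_rep (\<lambda>p. ?R (finv (snd p) \<circ> fst p))" by simp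
    from computable_task_bind[OF search this] show ?thesis
    proof (rule computable_task_mono)
      fix w v
      assume w: "w \<in> ran \<nu>" and "\<exists>e. (\<exists>i. e = pw i \<and> pw i c \<le> w c \<and> w c < pw i (h c)) \<and>
        e \<in> ran \<nu> \<and> v = ?R (finv (snd (w, e)) \<circ> fst (w, e))"
      then obtain i where i: "pw i c \<le> w c" "w c < pw i (h c)" "pw i \<in> ran \<nu>"
        and v: "v = ?R (finv (pw i) \<circ> w)" by auto
      have "finv (pw i) \<circ> w \<in> ran \<nu>"
        using subgroup_PL_comp[OF subgroup_ran w] i(3) subgroup_ran by (simp add: subgroup_PL_iff)
      from extension_iff[OF closed ran_PL[OF w] i(1,2) finite_orbitals[OF this]] v
      show "v = (w \<in> extension)" by simp
    qed auto
  qed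
  ultimately have "computable_fun \<nu> UNIV bool_rep (\<lambda>w. (a < w c \<and> w c < b) \<and> w \<in> extension)"
    by (rule computable_conj)
  then have "computable_fun \<nu> UNIV bool_rep (\<lambda>w. w \<in> extension)"
    by (rule computable_task_mono) (use extension_c in auto)
  then show ?thesis
    using subgroup_extension incl extension_factor_closed[OF closed] by (auto simp: splits_decidably_def)
qed

end

section \<open>Induction on the set of bumps\<close>

lemma generate_superset: "S \<subseteq> generate G S"
  by (rule subsetI) (rule generate.incl)

lemma PL_generate_mono:
  assumes "S \<subseteq> generate PL_group S'" "S' \<subseteq> PL_plus"
  shows "generate PL_group S \<subseteq> generate PL_group S'"
  using assms by (intro PL.generate_subgroup_incl PL.generate_is_subgroup) auto

lemma one_bumps_subset:
  "one_bumps_with_fundamental_domains X \<Longrightarrow> Y \<subseteq> X \<Longrightarrow> one_bumps_with_fundamental_domains Y"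
  unfolding one_bumps_with_fundamental_domains_def
proof (elim conjE, intro conjI)
  assume sub: "Y \<subseteq> X"
    and dom: "\<forall>h\<in>X. \<exists>r\<in>bump_supp h. \<forall>h'\<in>X. bump_supp h' \<subset> bump_supp h \<longrightarrow> bump_supp h' \<subseteq> {r<..<h r}"
  show "\<forall>h\<in>Y. \<exists>r\<in>bump_supp h. \<forall>h'\<in>Y. bump_supp h' \<subset> bump_supp h \<longrightarrow> bump_supp h' \<subseteq> {r<..<h r}"
  proof
    fix h assume "h \<in> Y"
    then obtain r where "r \<in> bump_supp h"
      "\<And>h'. h' \<in> X \<Longrightarrow> bump_supp h' \<subset> bump_supp h \<Longrightarrow> bump_supp h' \<subseteq> {r<..<h r}"
      using dom sub by (meson subsetD)
    then show "\<exists>r\<in>bump_supp h. \<forall>h'\<in>Y. bump_supp h' \<subset> bump_supp h \<longrightarrow> bump_supp h' \<subseteq> {r<..<h r}"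
      using sub by (intro bexI[of _ r]) auto
  qed
qed (simp_all add: subset_iff)

text \<open>Overlapping intervals of which neither contains the other form a transition chain in one
  of the two orders.\<close>

lemma disjoint_if_not_nested:
  assumes "a < b" "p < q"
    and "\<not> transition_chain {a<..<b} {p<..<q}" "\<not> transition_chain {p<..<q} {a<..<b}"
    and "\<not> {p<..<q} \<subseteq> {a<..<b}" "\<not> {a<..<b} \<subseteq> {p<..<q}"
  shows "{a<..<b} \<inter> {p<..<q} = {}"
proof (rule ccontr)
  assume "{a<..<b} \<inter> {p<..<q} \<noteq> {}"
  then have "p < b" "a < q" by auto
  consider "a < p" "b < q" | "p < a" "q < b" | "a \<le> p" "q \<le> b" | "p \<le> a" "b \<le> q"
    by linarith
  then show False
  proof cases
    case 1
    with \<open>p < b\<close> assms(3) show ?thesis unfolding transition_chain_def by blast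
  next
    case 2
    with \<open>a < q\<close> assms(4) show ?thesis unfolding transition_chain_def by blast
  qed (use assms(5,6) in auto)
qed

context computable_subgroup
begin

text \<open>An element with a single orbital is its own one-bump factor, hence one of the generators
  of the split group.\<close>

lemma C_ran:
  assumes "h \<in> C" "orbitals h = {A}"
  shows "h \<in> ran \<nu>"
proof -
  have hPL: "h \<in> PL_plus" using assms C_PL by blast
  obtain x y where xy: "bump_supp h = {x<..<y}" "\<And>z. z \<notin> {x<..<y} \<Longrightarrow> h z = z"
    using bump_supp_eq[OF hPL exI, OF assms(2)] by blast
  have "bump_supp h = A" using assms(2) by (simp add: bump_supp_def)
  then have "one_bump_factor h A = h" using xy by (auto simp: one_bump_factor_def fun_eq_iff)
  have "A \<in> orbitals h" using assms(2) by simp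
  with assms(1) have "one_bump_factor h A \<in> split_group C"
    unfolding split_group_def by (intro generate.incl) blast
  with \<open>one_bump_factor h A = h\<close> show ?thesis by (simp add: ran_\<nu>)
qed

text \<open>Brings \<open>h\<close> and \<open>T\<close> into the form of
  \<open>computable_bump_extension\<close>. What has to be found is the right orientation of
  \<open>h\<close> and a represented point \<open>c\<close> at which the fundamental domain may
  begin.\<close>

lemma splits_decidably_insert:
  assumes hC: "h \<in> C" and X: "one_bumps_with_fundamental_domains (insert h T)" and "finite T"
    and nested: "\<And>t. t \<in> T \<Longrightarrow> bump_supp t \<subset> bump_supp h" and TC: "T \<subseteq> C"
    and T: "splits_decidably (generate PL_group T)"
  shows "splits_decidably (generate PL_group (insert h T))"
proof -
  have XPL: "insert h T \<subseteq> PL_plus" and orb: "\<And>t. t \<in> insert h T \<Longrightarrow> \<exists>A. orbitals t = {A}"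
    using X by (auto simp: one_bumps_with_fundamental_domains_def)
  then have hPL: "h \<in> PL_plus" and TPL: "T \<subseteq> PL_plus" by auto
  have h_ran: "h \<in> ran \<nu>" using orb[OF insertI1] C_ran[OF hC] by blast
  obtain a b where ab: "bump_on h a b" "bump_supp h = {a<..<b}" "\<And>z. z \<notin> {a<..<b} \<Longrightarrow> h z = z"
    using bump_supp_eq[OF hPL orb[OF insertI1]] by blast
  have inv_h: "generate PL_group (insert (finv h) T) = generate PL_group (insert h T)"
  proof
    have "finv h \<in> generate PL_group (insert h T)"
      using generate.inv[of h "insert h T" PL_group] PL_m_inv[OF hPL] by simp
    then show "generate PL_group (insert (finv h) T) \<subseteq> generate PL_group (insert h T)"
      using XPL generate_superset[of "insert h T" PL_group] by (intro PL_generate_mono) simp_all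
    have "finv (finv h) = h" by (rule inv_inv_eq) (use PL_plusD[OF hPL] in \<open>simp add: bij_def\<close>)
    then have "h \<in> generate PL_group (insert (finv h) T)"
      using generate.inv[of "finv h" "insert (finv h) T" PL_group] PL_m_inv[OF PL_inv[OF hPL]] by simp
    then show "generate PL_group (insert h T) \<subseteq> generate PL_group (insert (finv h) T)"
      using XPL PL_inv[OF hPL] generate_superset[of "insert (finv h) T" PL_group]
      by (intro PL_generate_mono) simp_all
  qed
  \<comment> \<open>The element \<open>g\<close> will be whichever of \<open>h\<close> and its
    inverse moves points up.\<close>
  have gen: "splits_decidably (generate PL_group (insert g T))"
    if g: "g \<in> ran \<nu>" "\<And>z. z \<notin> {a<..<b} \<Longrightarrow> g z = z" "\<And>z. z \<in> {a<..<b} \<Longrightarrow> z < g z"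
      and c: "c \<in> {a<..<b}" "c \<in> ran \<pi>" and T_off: "\<And>t z. t \<in> T \<Longrightarrow> z \<notin> {c<..<g c} \<Longrightarrow> t z = z"
    for g c
  proof -
    have "generate PL_group T \<subseteq> {f \<in> PL_plus. \<forall>z\<in>- {c<..<g c}. f z = z}"
      using T_off TPL by (intro PL.generate_subgroup_incl subgroup_pointwise_stabilizer) auto
    then have off: "t z = z" if "t \<in> generate PL_group T" "z \<notin> {c<..<g c}" for t z
      using that by auto
    interpret computable_bump_extension C \<nu> \<pi> \<sigma> g a b c "generate PL_group T"
    proof (intro computable_bump_extension.intro computable_bump_extension_axioms.intro
        bump_extension.intro computable_subgroup_axioms)
      show "subgroup (generate PL_group T) PL_group" by (rule PL.generate_is_subgroup[OF TPL])
    qed (fact g ran_PL[OF g(1)] c off bump_ends_ran[OF h_ran ab(1)] T)+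
    have "generate PL_group (insert g (generate PL_group T)) = generate PL_group (insert g T)"
    proof
      have "generate PL_group T \<subseteq> generate PL_group (insert g T)"
        by (rule PL.mono_generate) auto
      then show "generate PL_group (insert g (generate PL_group T)) \<subseteq> generate PL_group (insert g T)"
        using TPL ran_PL[OF g(1)] generate_superset[of "insert g T" PL_group]
        by (intro PL_generate_mono) simp_all
      show "generate PL_group (insert g T) \<subseteq> generate PL_group (insert g (generate PL_group T))"
        using generate_superset[of T PL_group] by (intro PL.mono_generate) blast
    qed
    with splits_decidably_extension show ?thesis by simp
  qed
  show ?thesis
  proof (cases "T = {}")
    case True
    \<comment> \<open>With nothing nested in \<open>h\<close>, any represented point of the orbital
      may serve as \<open>c\<close>.\<close>
    obtain c where "c \<in> {a<..<b}" "c \<in> breakpoints h" using ex_breakpoint_in_bump[OF hPL ab(1)] by blast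
    then have c: "c \<in> {a<..<b}" "c \<in> ran \<pi>" using breakpoint_ran[OF h_ran] by auto
    from bump_direction[OF hPL ab(1)] show ?thesis
    proof
      assume "\<forall>z\<in>{a<..<b}. z < h z"
      then show ?thesis using True by (intro gen[OF h_ran ab(3) _ c]) simp_all
    next
      assume down: "\<forall>z\<in>{a<..<b}. h z < z"
      have "splits_decidably (generate PL_group (insert (finv h) T))"
      proof (rule gen[OF _ _ _ c])
        show "finv h \<in> ran \<nu>" using h_ran subgroup_ran by (simp add: subgroup_PL_iff)
        show fixed: "finv h z = z" if "z \<notin> {a<..<b}" for z
          using ab(3)[OF that] PL_inv_simps(2)[OF hPL, of z] by simp
        show "z < finv h z" if "z \<in> {a<..<b}" for z
        proof -
          have "h a = a" "h b = b" using ab(1) by (auto simp: bump_on_def)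
          from PL_bump_closed[OF hPL this, of "finv h z"] that
          have "finv h z \<in> {a<..<b}" by (simp add: PL_inv_simps[OF hPL])
          with down have "h (finv h z) < finv h z" by blast
          then show ?thesis by (simp add: PL_inv_simps[OF hPL])
        qed
      qed (use True in auto)
      then show ?thesis by (simp add: inv_h)
    qed
  next
    case False
    obtain r where r: "r \<in> {a<..<b}"
      "\<And>t. t \<in> T \<Longrightarrow> bump_supp t \<subseteq> {r<..<h r}"
    proof -
      have "\<forall>g\<in>insert h T. \<exists>r\<in>bump_supp g. \<forall>t\<in>insert h T.
          bump_supp t \<subset> bump_supp g \<longrightarrow> bump_supp t \<subseteq> {r<..<g r}"
        using X unfolding one_bumps_with_fundamental_domains_def by (elim conjE)
      from this[THEN bspec, OF insertI1] obtain r where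
        "r \<in> bump_supp h" "\<forall>t\<in>insert h T. bump_supp t \<subset> bump_supp h \<longrightarrow> bump_supp t \<subseteq> {r<..<h r}"
        by (elim bexE)
      with that nested ab(2) show ?thesis by simp
    qed
    have T_bump: "\<exists>x y. bump_on t x y \<and> bump_supp t = {x<..<y} \<and> (\<forall>z. z \<notin> {x<..<y} \<longrightarrow> t z = z)"
      if "t \<in> T" for t
      by (rule bump_supp_eq) (use orb[of t] TPL that in auto)
    \<comment> \<open>The point \<open>r\<close> of the hypothesis may have no representative, so it
      is replaced by the least left endpoint of the nested bumps. As \<open>r \<le> c\<close>, also
      \<open>h r \<le> h c\<close>, and the nested bumps still fit between \<open>c\<close> and
      \<open>h c\<close>.\<close>
    define c where "c = Min ((\<lambda>t. Inf (bump_supp t)) ` T)"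
    have "c \<in> (\<lambda>t. Inf (bump_supp t)) ` T"
      unfolding c_def using False \<open>finite T\<close> by (intro Min_in) auto
    then obtain s where s: "s \<in> T" "c = Inf (bump_supp s)" by blast
    obtain p q where pq: "bump_on s p q" "bump_supp s = {p<..<q}" using T_bump[OF s(1)] by blast
    then have "p < q" by (simp add: bump_on_def)
    with pq s have "c = p" by simp
    have rc: "r \<le> c" "q \<le> h r"
      using r(2)[OF s(1)] \<open>p < q\<close> \<open>c = p\<close> unfolding pq(2) greaterThanLessThan_subseteq_greaterThanLessThan by auto
    have "h a = a" "h b = b" using ab(1) by (auto simp: bump_on_def)
    from PL_bump_closed[OF hPL this, of r] r(1) have "h r \<in> {a<..<b}" by simp
    with rc r(1) \<open>p < q\<close> \<open>c = p\<close> have cab: "c \<in> {a<..<b}" and "r < h r" by auto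
    have cran: "c \<in> ran \<pi>"
    proof -
      obtain A where "orbitals s = {A}" using orb[of s] s(1) by auto
      with C_ran[of s A] TC s(1) have "s \<in> ran \<nu>" by auto
      from bump_ends_ran(1)[OF this pq(1)] \<open>c = p\<close> show ?thesis by simp
    qed
    \<comment> \<open>A nested bump occupies room between \<open>r\<close> and \<open>h r\<close>,
      so \<open>r\<close> is moved up, and with it the whole orbital.\<close>
    have up: "z < h z" if "z \<in> {a<..<b}" for z
      using bump_direction[OF hPL ab(1)]
    proof
      assume "\<forall>z\<in>{a<..<b}. h z < z"
      from bspec[OF this r(1)] \<open>r < h r\<close> show ?thesis by simp
    qed (use that in blast)
    have off: "t z = z" if t: "t \<in> T" and z: "z \<notin> {c<..<h c}" for t z
    proof -
      obtain x y where xy: "bump_on t x y" "bump_supp t = {x<..<y}" "\<And>z. z \<notin> {x<..<y} \<Longrightarrow> t z = z"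
        using T_bump[OF t] by blast
      then have "x < y" by (simp add: bump_on_def)
      have "c \<le> Inf (bump_supp t)"
        unfolding c_def using \<open>finite T\<close> t by (intro Min_le) auto
      then have "c \<le> x" using xy(2) \<open>x < y\<close> by simp
      moreover have "y \<le> h r"
        using r(2)[OF t] \<open>x < y\<close> unfolding xy(2) greaterThanLessThan_subseteq_greaterThanLessThan by auto
      moreover have "h r \<le> h c" using rc by (simp add: PL_le_iff[OF hPL])
      ultimately show ?thesis using z by (intro xy(3)) auto
    qed
    show ?thesis by (rule gen[of h c]) (fact h_ran ab(3) up cab cran off)+
  qed
qed

text \<open>The induction hypothesis is applied to \<open>T\<close> and to \<open>R\<close>, which
  both omit \<open>h\<close>. It is not applied to \<open>insert h T\<close>, which may be all of
  \<open>X\<close>; that set is handled by \<open>splits_decidably_insert\<close>.\<close>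

lemma splits_decidably_bumps:
  assumes "finite X" "X \<subseteq> C" "one_bumps_with_fundamental_domains X"
  shows "splits_decidably (generate PL_group X)"
  using assms
proof (induction X rule: finite_psubset_induct)
  case (psubset X)
  show ?case
  proof (cases "X = {}")
    case True
    then show ?thesis using splits_decidably_trivial PL.generate_empty by simp
  next
    case False
    have XPL: "X \<subseteq> PL_plus" and orb: "\<And>t. t \<in> X \<Longrightarrow> \<exists>A. orbitals t = {A}"
      and chain: "\<And>s t. s \<in> X \<Longrightarrow> t \<in> X \<Longrightarrow> \<not> transition_chain (bump_supp s) (bump_supp t)"
      and inj: "\<And>s t. s \<in> X \<Longrightarrow> t \<in> X \<Longrightarrow> s \<noteq> t \<Longrightarrow> bump_supp s \<noteq> bump_supp t"
      using psubset.prems(2) by (auto simp: one_bumps_with_fundamental_domains_def)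
    obtain h where h: "h \<in> X" and max: "\<And>t. t \<in> X \<Longrightarrow> bump_supp h \<subseteq> bump_supp t \<Longrightarrow> bump_supp t = bump_supp h"
      using finite_has_maximal[of "bump_supp ` X"] False \<open>finite X\<close> by fastforce
    define T where "T = {t \<in> X. bump_supp t \<subset> bump_supp h}"
    define R where "R = {t \<in> X. t \<noteq> h \<and> \<not> bump_supp t \<subset> bump_supp h}"
    have X_eq: "X = insert h T \<union> R" using h by (auto simp: T_def R_def)
    have "T \<subset> X" "R \<subset> X" using h by (auto simp: T_def R_def)
    have IH: "splits_decidably (generate PL_group Y)" if "Y \<subset> X" for Y
      using psubset.IH[OF that] psubset.prems that one_bumps_subset by blast
    have hT: "splits_decidably (generate PL_group (insert h T))"
    proof (rule splits_decidably_insert)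
      show "one_bumps_with_fundamental_domains (insert h T)"
        using psubset.prems(2) X_eq one_bumps_subset by blast
      show "finite T" using \<open>finite X\<close> X_eq by (metis finite_Un finite_insert)
    qed (use h psubset.prems IH[OF \<open>T \<subset> X\<close>] in \<open>auto simp: T_def\<close>)
    have bumps: "\<exists>x y. bump_on t x y \<and> bump_supp t = {x<..<y} \<and> (\<forall>z. z \<notin> {x<..<y} \<longrightarrow> t z = z)"
      if "t \<in> X" for t
      by (rule bump_supp_eq) (use orb[OF that] XPL that in auto)
    obtain a b where ab: "bump_on h a b" "bump_supp h = {a<..<b}" "\<And>z. z \<notin> {a<..<b} \<Longrightarrow> h z = z"
      using bumps[OF h] by blast
    then have "a < b" by (simp add: bump_on_def)
    have h_ran: "h \<in> ran \<nu>" using C_ran[of h] h orb[OF h] psubset.prems(1) by blast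
    have "t z = z" if t: "t \<in> insert h T" and z: "z \<notin> {a<..<b}" for t z
    proof (cases "t = h")
      case False
      with t have "t \<in> X" "bump_supp t \<subseteq> {a<..<b}" using ab(2) by (auto simp: T_def)
      with bumps z show ?thesis by blast
    qed (use ab z in simp)
    then have "generate PL_group (insert h T) \<subseteq> {f \<in> PL_plus. \<forall>z\<in>- {a<..<b}. f z = z}"
      using XPL X_eq by (intro PL.generate_subgroup_incl subgroup_pointwise_stabilizer) blast+
    then have off1: "g z = z" if "g \<in> generate PL_group (insert h T)" "z \<notin> {a<..<b}" for g z
      using that by auto
    have "t z = z" if t: "t \<in> R" and z: "z \<in> {a<..<b}" for t z
    proof -
      have tX: "t \<in> X" "t \<noteq> h" "\<not> bump_supp t \<subset> bump_supp h" using t by (auto simp: R_def)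
      obtain p q where pq: "bump_on t p q" "bump_supp t = {p<..<q}" "\<And>z. z \<notin> {p<..<q} \<Longrightarrow> t z = z"
        using bumps[OF tX(1)] by blast
      \<comment> \<open>The support of \<open>t\<close> does not properly contain that of
        \<open>h\<close> by maximality, is not equal to it because distinct bumps have distinct
        supports, and is not properly contained in it because \<open>t\<close> is in
        \<open>R\<close>.\<close>
      have "{a<..<b} \<inter> {p<..<q} = {}"
      proof (rule disjoint_if_not_nested[OF \<open>a < b\<close>])
        show "p < q" using pq by (simp add: bump_on_def)
        show "\<not> transition_chain {a<..<b} {p<..<q}" "\<not> transition_chain {p<..<q} {a<..<b}"
          using chain[OF h tX(1)] chain[OF tX(1) h] ab pq by auto
        show "\<not> {p<..<q} \<subseteq> {a<..<b}" "\<not> {a<..<b} \<subseteq> {p<..<q}"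
          using inj[OF tX(1) h tX(2)] tX(3) max[OF tX(1)] ab pq by auto
      qed
      with z pq(3) show ?thesis by blast
    qed
    then have "generate PL_group R \<subseteq> {f \<in> PL_plus. \<forall>z\<in>{a<..<b}. f z = z}"
      using XPL X_eq by (intro PL.generate_subgroup_incl subgroup_pointwise_stabilizer) blast+
    then have off2: "g z = z" if "g \<in> generate PL_group R" "z \<in> {a<..<b}" for g z
      using that by auto
    let ?G = "generate PL_group (insert h T) \<union> generate PL_group R"
    have "generate PL_group ?G = generate PL_group X"
    proof
      have "generate PL_group (insert h T) \<subseteq> generate PL_group X" "generate PL_group R \<subseteq> generate PL_group X"
        using X_eq by (intro PL.mono_generate; blast)+
      then show "generate PL_group ?G \<subseteq> generate PL_group X"
        using XPL by (intro PL_generate_mono) auto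
      have "X \<subseteq> ?G" unfolding X_eq by (auto intro: generate.incl)
      then show "generate PL_group X \<subseteq> generate PL_group ?G" by (rule PL.mono_generate)
    qed
    moreover have "splits_decidably (generate PL_group ?G)"
      by (rule splits_decidably_disjoint[OF hT IH[OF \<open>R \<subset> X\<close>] \<open>a < b\<close> bump_ends_ran[OF h_ran ab(1)]])
        (fact off1, fact off2)
    ultimately show ?thesis by simp
  qed
qed

end

theorem corollary4p6:
  fixes C H X :: "(real \<Rightarrow> real) set"
    and \<nu> :: "nat \<rightharpoonup> (real \<Rightarrow> real)"
    and \<pi> \<sigma> :: "nat \<rightharpoonup> real"
  assumes "computable_subgroup C \<nu> \<pi> \<sigma>"
    and "finite X"
    and "one_bumps_with_fundamental_domains X"
    and "H = generate PL_group X"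
    and "subgroup H (PL_group\<lparr>carrier := C\<rparr>)"
  shows "membership_decidable \<nu> C H"
proof -
  interpret computable_subgroup C \<nu> \<pi> \<sigma> by fact
  have "X \<subseteq> H" unfolding assms(4) by (auto intro: generate.incl)
  moreover have "H \<subseteq> C" using subgroup.subset[OF assms(5)] by simp
  ultimately have "splits_decidably H"
    unfolding assms(4) using assms by (intro splits_decidably_bumps) auto
  then have "computable_fun \<nu> UNIV bool_rep (\<lambda>w. w \<in> H)" by (simp add: splits_decidably_def)
  then show ?thesis unfolding membership_decidable_def by (rule computable_task_mono) auto
qed

end
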